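(* Given a finite idempotent algebra $\mathbf{A}$ (presented by the list of its elements and the tables of its finitely many basic operations) as input, the algorithm BLOCKER described in the context will, in time polynomial in the size of the input, either find (return) a cube term blocker in $\mathbf{A}$, or correctly conclude (by returning "No") that $\mathbf{A}$ has a cube term and thus contains no cube term blocker.
   Context: Write $[n]=\{1,\dots,n\}$. For $\mathbf{a},\mathbf{b}\in A^n$ and $I\subseteq[n]$, let $\chi_I(\mathbf{a},\mathbf{b})\in A^n$ be the tuple whose $i$-th entry is $b_i$ if $i\in I$ and $a_i$ if $i\notin I$. An algebra is idempotent if $t(a,\dots,a)=a$ for each of its operations $t$ and each $a\in A$. A cube term of dimension $d$ of $\mathbf{A}$ is a $(2^d-1)$-ary term operation $t$ of $\mathbf{A}$, with arguments indexed by the nonempty subsets of $[d]$, such that $t(\chi_I(\mathbf{a},\mathbf{b})\colon \emptyset\neq I\subseteq[d])=\mathbf{a}$ for all $\mathbf{a},\mathbf{b}\in A^d$ ($t$ applied coordinatewise); a cube term is a cube term of some dimension. $\mathrm{Sg}(X)$ denotes the subuniverse of $\mathbf{A}$ generated by $X$, and $\mathrm{Sg}(c,d)=\mathrm{Sg}(\{c,d\})$. A cube term blocker of an idempotent algebra $\mathbf{A}$ is a pair $(C,D)$ of nonempty subuniverses of $\mathbf{A}$ with $C\subsetneq D$ such that for every positive integer $n$ the relation $D^n\setminus(D\setminus C)^n$ is a subuniverse of $\mathbf{A}^n$. The size of the input is the number of elements of $A$ plus $|A|^q$ for each basic operation of arity $q$. Algorithm BLOCKER: For each $c\in A$ do the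 following. Set $S:=\{c\}$. While $S\neq A$: choose $d\in A\setminus S$ such that $\mathrm{Sg}(c,d)$ is inclusion minimal among all sets $\mathrm{Sg}(c,d')$ with $d'\in A\setminus S$; if $(S\cap\mathrm{Sg}(c,d),\mathrm{Sg}(c,d))$ is a cube term blocker, return this pair and stop; otherwise set $S:=S\cup\mathrm{Sg}(c,d)$ and continue the while loop. If all $c\in A$ have been processed without returning, return "No". The test whether $(C,D)$ is a cube term blocker is performed as follows: check that $\emptyset\neq C\subsetneq D$ and that $C,D$ are subuniverses of $\mathbf{A}$, and then check that for each basic operation $f$ of $\mathbf{A}$ there is a coordinate $j$ such that $f(d_1,\dots,d_{j-1},c',d_{j+1},\dots,d_q)\in C$ for all $c'\in C$ and all $d_i\in D$ (where $q$ is the arity of $f$). *)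

theory Defs
  imports
    "HOL-Library.FuncSet"
    "HOL-Library.Monad_Syntax"
    "HOL-Computational_Algebra.Polynomial"
begin

section \<open>Algebras, term operations, cube terms and cube term blockers\<close>

text \<open>A basic operation is a pair of its arity and a function on argument lists; only the values
  on lists of that length over the carrier matter.\<close>

record 'a alg =
  carrier :: "'a set"
  ops :: "(nat \<times> ('a list \<Rightarrow> 'a)) list"

definition subuniverse :: "'a alg \<Rightarrow> 'a set \<Rightarrow> bool" where
  "subuniverse \<A> B \<longleftrightarrow> B \<subseteq> carrier \<A> \<and>
     (\<forall>(q, f) \<in> set (ops \<A>). \<forall>as. length as = q \<and> set as \<subseteq> B \<longrightarrow> f as \<in> B)"

definition algebra :: "'a alg \<Rightarrow> bool" where
  "algebra \<A> \<longleftrightarrow>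
     (\<forall>(q, f) \<in> set (ops \<A>). \<forall>as. length as = q \<and> set as \<subseteq> carrier \<A> \<longrightarrow> f as \<in> carrier \<A>)"

definition idempotent :: "'a alg \<Rightarrow> bool" where
  "idempotent \<A> \<longleftrightarrow> (\<forall>(q, f) \<in> set (ops \<A>). \<forall>a \<in> carrier \<A>. f (replicate q a) = a)"

text \<open>The \<open>n\<close>-th power; its elements are the extensional functions on \<open>{1..n}\<close>.\<close>

definition power_alg :: "nat \<Rightarrow> 'a alg \<Rightarrow> (nat \<Rightarrow> 'a) alg" where
  "power_alg n \<A> =
     \<lparr>carrier = {1..n} \<rightarrow>\<^sub>E carrier \<A>,
      ops = map (\<lambda>(q, f). (q, \<lambda>rs. \<lambda>i\<in>{1..n}. f (map (\<lambda>r. r i) rs))) (ops \<A>)\<rparr>"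

text \<open>Term operations whose arguments are indexed by an arbitrary set \<open>J\<close>.\<close>

inductive term_op :: "'a alg \<Rightarrow> 'i set \<Rightarrow> (('i \<Rightarrow> 'a) \<Rightarrow> 'a) \<Rightarrow> bool"
  for \<A> :: "'a alg" and J :: "'i set" where
  proj: "j \<in> J \<Longrightarrow> term_op \<A> J (\<lambda>x. x j)"
| app: "(q, f) \<in> set (ops \<A>) \<Longrightarrow> length ts = q \<Longrightarrow> (\<And>t. t \<in> set ts \<Longrightarrow> term_op \<A> J t)
    \<Longrightarrow> term_op \<A> J (\<lambda>x. f (map (\<lambda>t. t x) ts))"

definition chi :: "nat set \<Rightarrow> (nat \<Rightarrow> 'a) \<Rightarrow> (nat \<Rightarrow> 'a) \<Rightarrow> nat \<Rightarrow> 'a" where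
  "chi I a b = (\<lambda>i. if i \<in> I then b i else a i)"

definition cube_term :: "'a alg \<Rightarrow> nat \<Rightarrow> ((nat set \<Rightarrow> 'a) \<Rightarrow> 'a) \<Rightarrow> bool" where
  "cube_term \<A> d t \<longleftrightarrow> d \<ge> 1 \<and> term_op \<A> (Pow {1..d} - {{}}) t \<and>
     (\<forall>a \<in> {1..d} \<rightarrow>\<^sub>E carrier \<A>. \<forall>b \<in> {1..d} \<rightarrow>\<^sub>E carrier \<A>. \<forall>i \<in> {1..d}.
        t (\<lambda>I. chi I a b i) = a i)"

definition has_cube_term :: "'a alg \<Rightarrow> bool" where
  "has_cube_term \<A> \<longleftrightarrow> (\<exists>d t. cube_term \<A> d t)"

definition cube_term_blocker :: "'a alg \<Rightarrow> 'a set \<Rightarrow> 'a set \<Rightarrow> bool" where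
  "cube_term_blocker \<A> C D \<longleftrightarrow>
     C \<noteq> {} \<and> D \<noteq> {} \<and> subuniverse \<A> C \<and> subuniverse \<A> D \<and> C \<subset> D \<and>
     (\<forall>n\<ge>1. subuniverse (power_alg n \<A>) (({1..n} \<rightarrow>\<^sub>E D) - ({1..n} \<rightarrow>\<^sub>E (D - C))))"


section \<open>Presentation of a finite algebra\<close>

text \<open>An operation table consists of the arity and a list of rows (argument list, value).\<close>

type_synonym 'a table = "nat \<times> ('a list \<times> 'a) list"

definition table_of :: "'a set \<Rightarrow> nat \<times> ('a list \<Rightarrow> 'a) \<Rightarrow> 'a table \<Rightarrow> bool" where
  "table_of A = (\<lambda>(q, f) (q', rows). q' = q \<and> distinct rows \<and>
     set rows = {(as, f as) | as. length as = q \<and> set as \<subseteq> A})"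

definition presents :: "'a list \<Rightarrow> 'a table list \<Rightarrow> 'a alg \<Rightarrow> bool" where
  "presents elems tabs \<A> \<longleftrightarrow> distinct elems \<and> set elems = carrier \<A> \<and>
     list_all2 (table_of (carrier \<A>)) (ops \<A>) tabs"

definition input_size :: "'a alg \<Rightarrow> nat" where
  "input_size \<A> = card (carrier \<A>) + (\<Sum>(q, f) \<leftarrow> ops \<A>. card (carrier \<A>) ^ q)"


section \<open>Computations with running time\<close>

text \<open>A computation is \<open>Some (x, t)\<close> if it returns \<open>x\<close> after \<open>t\<close> steps; it is \<open>None\<close> if it diverges or
  aborts. Every call of a recursive function and every loop iteration costs one step. Within one
  step only a bounded number of elementary operations is performed: constructing and matching
  list cells and pairs, conditionals, arithmetic on indices, comparing two elements of the algebra.\<close>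

type_synonym 'b timed = "('b \<times> nat) option"

definition ret :: "'b \<Rightarrow> 'b timed" where
  "ret x = Some (x, 0)"

definition tick :: "'b timed \<Rightarrow> 'b timed" where
  "tick m = map_option (\<lambda>(x, t). (x, t + 1)) m"

definition bind_timed :: "'b timed \<Rightarrow> ('b \<Rightarrow> 'c timed) \<Rightarrow> 'c timed" where
  "bind_timed m k = Option.bind m (\<lambda>(x, t). map_option (\<lambda>(y, t'). (y, t + t')) (k x))"

no_adhoc_overloading Monad_Syntax.bind \<rightleftharpoons> Option.bind
adhoc_overloading Monad_Syntax.bind \<rightleftharpoons> bind_timed

lemma mono_option_map:
  fixes m :: "('e \<Rightarrow> 'f option) \<Rightarrow> 'b option"
  assumes "mono_option m"
  shows "mono_option (\<lambda>F. map_option h (m F))"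
proof (rule monotoneI)
  fix F G :: "'e \<Rightarrow> 'f option"
  assume "option.le_fun F G"
  then have "m F = None \<or> m F = m G"
    using assms by (auto dest: monotoneD simp: flat_ord_def)
  then show "option_ord (map_option h (m F)) (map_option h (m G))"
    by (auto simp: flat_ord_def)
qed

lemma mono_tick [partial_function_mono]:
  assumes "mono_option m"
  shows "mono_option (\<lambda>F. tick (m F))"
  unfolding tick_def by (rule mono_option_map[OF assms])

lemma mono_bind_timed [partial_function_mono]:
  assumes "mono_option m" and "\<And>x. mono_option (\<lambda>F. k x F)"
  shows "mono_option (\<lambda>F. bind_timed (m F) (\<lambda>x. k x F))"
  unfolding bind_timed_def
  by (intro bind_mono assms(1)) (simp only: case_prod_beta mono_option_map assms(2))

definition and_timed :: "bool timed \<Rightarrow> bool timed \<Rightarrow> bool timed" (infixr "\<and>\<^sub>T" 35) where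
  "(m \<and>\<^sub>T m') = do { b \<leftarrow> m; if b then m' else ret False }"

definition imp_timed :: "bool timed \<Rightarrow> bool timed \<Rightarrow> bool timed" (infixr "\<longrightarrow>\<^sub>T" 25) where
  "(m \<longrightarrow>\<^sub>T m') = do { b \<leftarrow> m; if b then m' else ret True }"

definition not_timed :: "bool timed \<Rightarrow> bool timed" ("\<not>\<^sub>T _" [40] 40) where
  "(\<not>\<^sub>T m) = do { b \<leftarrow> m; ret (\<not> b) }"

fun mapT :: "('b \<Rightarrow> 'c timed) \<Rightarrow> 'b list \<Rightarrow> 'c list timed" where
  "mapT f [] = tick (ret [])"
| "mapT f (x # xs) = tick (do { y \<leftarrow> f x; ys \<leftarrow> mapT f xs; ret (y # ys) })"

fun filterT :: "('b \<Rightarrow> bool timed) \<Rightarrow> 'b list \<Rightarrow> 'b list timed" where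
  "filterT p [] = tick (ret [])"
| "filterT p (x # xs) =
     tick (do { b \<leftarrow> p x; ys \<leftarrow> filterT p xs; ret (if b then x # ys else ys) })"

fun foldT :: "('b \<Rightarrow> 'c \<Rightarrow> 'c timed) \<Rightarrow> 'b list \<Rightarrow> 'c \<Rightarrow> 'c timed" where
  "foldT f [] s = tick (ret s)"
| "foldT f (x # xs) s = tick (do { s' \<leftarrow> f x s; foldT f xs s' })"

fun allT :: "('b \<Rightarrow> bool timed) \<Rightarrow> 'b list \<Rightarrow> bool timed" where
  "allT p [] = tick (ret True)"
| "allT p (x # xs) = tick (do { b \<leftarrow> p x; if b then allT p xs else ret False })"

fun ex_belowT :: "(nat \<Rightarrow> bool timed) \<Rightarrow> nat \<Rightarrow> bool timed" where
  "ex_belowT p 0 = tick (ret False)"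
| "ex_belowT p (Suc n) = tick (do { b \<leftarrow> p n; if b then ret True else ex_belowT p n })"

fun nthT :: "'b list \<Rightarrow> nat \<Rightarrow> 'b timed" where
  "nthT [] i = None"
| "nthT (x # xs) i = tick (if i = 0 then ret x else nthT xs (i - 1))"

fun memT :: "'a \<Rightarrow> 'a list \<Rightarrow> bool timed" where
  "memT x [] = tick (ret False)"
| "memT x (y # ys) = tick (if x = y then ret True else memT x ys)"

text \<open>Sets of elements of the algebra are represented by lists without repetitions.\<close>

definition subsetT :: "'a list \<Rightarrow> 'a list \<Rightarrow> bool timed" where
  "subsetT xs ys = allT (\<lambda>x. memT x ys) xs"

definition insertT :: "'a \<Rightarrow> 'a list \<Rightarrow> 'a list timed" where
  "insertT x xs = do { b \<leftarrow> memT x xs; ret (if b then xs else x # xs) }"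

definition unionT :: "'a list \<Rightarrow> 'a list \<Rightarrow> 'a list timed" where
  "unionT xs ys = foldT insertT ys xs"

definition interT :: "'a list \<Rightarrow> 'a list \<Rightarrow> 'a list timed" where
  "interT xs ys = filterT (\<lambda>x. memT x ys) xs"


section \<open>The algorithm\<close>

definition close_onceT :: "'a table list \<Rightarrow> 'a list \<Rightarrow> 'a list timed" where
  "close_onceT tabs = foldT (\<lambda>(q, rows). foldT (\<lambda>(as, v) B. do {
       b \<leftarrow> subsetT as B;
       if b then insertT v B else ret B
     }) rows) tabs"

partial_function (option) closureT :: "'a table list \<Rightarrow> 'a list \<Rightarrow> 'a list timed" where
  "closureT tabs B = tick (do {
     B' \<leftarrow> close_onceT tabs B;
     stable \<leftarrow> subsetT B' B;
     if stable then ret B else closureT tabs B'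
   })"

definition SgT :: "'a table list \<Rightarrow> 'a \<Rightarrow> 'a \<Rightarrow> 'a list timed" where
  "SgT tabs c d = do { X \<leftarrow> insertT c [d]; closureT tabs X }"

definition subuniverseT :: "'a list \<Rightarrow> 'a table list \<Rightarrow> 'a list \<Rightarrow> bool timed" where
  "subuniverseT elems tabs B =
     (subsetT B elems \<and>\<^sub>T
      allT (\<lambda>(q, rows). allT (\<lambda>(as, v). subsetT as B \<longrightarrow>\<^sub>T memT v B) rows) tabs)"

text \<open>In the last conjunct the \<open>j\<close>-th argument is only required to be in \<open>C\<close> and in \<open>D\<close>, which is
  the same as being in \<open>C\<close> because \<open>C \<subseteq> D\<close> has been checked before.\<close>

definition blocker_testT :: "'a list \<Rightarrow> 'a table list \<Rightarrow> 'a list \<Rightarrow> 'a list \<Rightarrow> bool timed" where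
  "blocker_testT elems tabs C D =
     (ret (C \<noteq> []) \<and>\<^sub>T subsetT C D \<and>\<^sub>T (\<not>\<^sub>T subsetT D C) \<and>\<^sub>T
      subuniverseT elems tabs C \<and>\<^sub>T subuniverseT elems tabs D \<and>\<^sub>T
      allT (\<lambda>(q, rows). ex_belowT (\<lambda>j. allT (\<lambda>(as, v).
          (subsetT as D \<and>\<^sub>T do { x \<leftarrow> nthT as j; memT x C }) \<longrightarrow>\<^sub>T memT v C) rows) q) tabs)"

definition minimalsT :: "'a table list \<Rightarrow> 'a \<Rightarrow> 'a list \<Rightarrow> 'a list timed" where
  "minimalsT tabs c ds = do {
     Gs \<leftarrow> mapT (SgT tabs c) ds;
     filterT (\<lambda>d. do {
       G \<leftarrow> SgT tabs c d;
       allT (\<lambda>G'. \<not>\<^sub>T (subsetT G' G \<and>\<^sub>T (\<not>\<^sub>T subsetT G G'))) Gs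
     }) ds
   }"

text \<open>The choice of \<open>d\<close> among the admissible candidates is made by an arbitrary rule \<open>pick\<close>, which
  may depend on \<open>c\<close> and \<open>S\<close>. As a pair \<open>(c, S)\<close> does not recur within a run, quantifying over
  \<open>pick\<close> amounts to quantifying over all runs. A choice is charged as one
  traversal of the candidate list.\<close>

type_synonym 'a choice_rule = "'a \<Rightarrow> 'a list \<Rightarrow> 'a list \<Rightarrow> 'a"

definition choice_rule :: "'a choice_rule \<Rightarrow> bool" where
  "choice_rule pick \<longleftrightarrow> (\<forall>c S ds. ds \<noteq> [] \<longrightarrow> pick c S ds \<in> set ds)"

definition chooseT :: "'a choice_rule \<Rightarrow> 'a \<Rightarrow> 'a list \<Rightarrow> 'a list \<Rightarrow> 'a timed" where
  "chooseT pick c S ds = (if ds = [] then None else Some (pick c S ds, length ds))"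

text \<open>Since \<open>S\<close> is a subset of the carrier, \<open>S \<noteq> A\<close> is tested as \<open>\<not> A \<subseteq> S\<close>.\<close>

partial_function (option) while_loopT ::
  "'a choice_rule \<Rightarrow> 'a list \<Rightarrow> 'a table list \<Rightarrow> 'a \<Rightarrow> 'a list \<Rightarrow> ('a list \<times> 'a list) option timed" where
  "while_loopT pick elems tabs c S = tick (do {
     full \<leftarrow> subsetT elems S;
     if full then ret None
     else do {
       ds \<leftarrow> filterT (\<lambda>d. \<not>\<^sub>T memT d S) elems;
       ms \<leftarrow> minimalsT tabs c ds;
       d \<leftarrow> chooseT pick c S ms;
       D \<leftarrow> SgT tabs c d;
       C \<leftarrow> interT S D;
       b \<leftarrow> blocker_testT elems tabs C D;
       if b then ret (Some (C, D))
       else do {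
         S' \<leftarrow> unionT S D;
         while_loopT pick elems tabs c S'
       }
     }
   })"

fun for_eachT ::
  "'a choice_rule \<Rightarrow> 'a list \<Rightarrow> 'a table list \<Rightarrow> 'a list \<Rightarrow> ('a list \<times> 'a list) option timed" where
  "for_eachT pick elems tabs [] = tick (ret None)"
| "for_eachT pick elems tabs (c # cs) = tick (do {
     r \<leftarrow> while_loopT pick elems tabs c [c];
     (case r of Some CD \<Rightarrow> ret (Some CD) | None \<Rightarrow> for_eachT pick elems tabs cs)
   })"

text \<open>The result \<open>None\<close> stands for the answer No.\<close>

definition BLOCKER ::
  "'a choice_rule \<Rightarrow> 'a list \<Rightarrow> 'a table list \<Rightarrow> ('a list \<times> 'a list) option timed" where
  "BLOCKER pick elems tabs = for_eachT pick elems tabs elems"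

end

theory Submission
  imports Defs
begin

text \<open>
  Call \<open>(C, D)\<close> an operational blocker if every basic operation has a coordinate \<open>j\<close> such that it
  maps \<open>D \<times> \<dots> \<times> C \<times> \<dots> \<times> D\<close>, with \<open>C\<close> at \<open>j\<close>, into \<open>C\<close>. For idempotent algebras this is the same as a
  cube term blocker.

  Suppose that there is none. Then there is none in the power \<open>\<B> = \<A>\<^bsup>A \<times> A\<^esup>\<close> either. Let \<open>x, y\<close> be the two
  projections and \<open>D\<close> the subalgebra of \<open>\<B>\<close> generated by them, and let \<open>Q(C)\<close> be the subalgebra of
  \<open>D\<^bsup>\<omega>\<^esup>\<close> generated by all sequences with some entry in \<open>C\<close>. If the constant sequence \<open>x\<close> is not in
  \<open>Q({y})\<close>, take \<open>C\<close> maximal such that it is not in \<open>Q(C)\<close>. A sequence in \<open>Q(C)\<close> without entries in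
  \<open>C\<close> could be turned into the constant sequence \<open>x\<close>, entry by entry, by maximality of \<open>C\<close>; so every
  sequence in \<open>Q(C)\<close> has an entry in \<open>C\<close>, which makes \<open>(C, D)\<close> an operational blocker. Hence the
  constant sequence \<open>x\<close> is in \<open>Q({y})\<close>, and a term witnessing this is a cube term.

  If \<open>(C\<^sub>0, D\<^sub>0)\<close> is a blocker, the run for any \<open>c \<in> C\<^sub>0\<close> preserves \<open>S \<inter> D\<^sub>0 \<subseteq> C\<^sub>0\<close> until it returns
  a blocker, and this condition fails for \<open>S = A\<close>.
\<close>

section \<open>Blockers in terms of the basic operations\<close>

lemma subuniverseD:
  assumes "subuniverse \<A> B" "(q, f) \<in> set (ops \<A>)" "length as = q" "set as \<subseteq> B"
  shows "f as \<in> B"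
  using assms unfolding subuniverse_def by fastforce

lemma subuniverseI:
  assumes "B \<subseteq> carrier \<A>"
    and "\<And>q f as. (q, f) \<in> set (ops \<A>) \<Longrightarrow> length as = q \<Longrightarrow> set as \<subseteq> B \<Longrightarrow> f as \<in> B"
  shows "subuniverse \<A> B"
  using assms unfolding subuniverse_def by blast

lemma subuniverse_subset: "subuniverse \<A> B \<Longrightarrow> B \<subseteq> carrier \<A>"
  by (simp add: subuniverse_def)

lemma subuniverse_carrier: "algebra \<A> \<Longrightarrow> subuniverse \<A> (carrier \<A>)"
  by (simp add: algebra_def subuniverse_def)

text \<open>The form \<open>set as \<subseteq> {a}\<close> fits argument lists obtained by mapping.
  For arity 0 it holds for every \<open>a\<close>, which is how \<open>arity_pos\<close> excludes
  nullary operations.\<close>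

lemma idempotentD:
  assumes "idempotent \<A>" "(q, f) \<in> set (ops \<A>)" "length as = q" "set as \<subseteq> {a}" "a \<in> carrier \<A>"
  shows "f as = a"
proof -
  have "as = replicate q a"
    using assms(3,4) by (metis replicate_eqI singletonD subsetD)
  then show ?thesis
    using assms unfolding idempotent_def by fastforce
qed

lemma subuniverse_Int: "subuniverse \<A> B \<Longrightarrow> subuniverse \<A> B' \<Longrightarrow> subuniverse \<A> (B \<inter> B')"
  by (fastforce simp: subuniverse_def)

section \<open>Generated subuniverses\<close>

definition Sg :: "'a alg \<Rightarrow> 'a set \<Rightarrow> 'a set" where
  "Sg \<A> X = \<Inter> {B. subuniverse \<A> B \<and> X \<subseteq> B}"

lemma Sg_superset: "X \<subseteq> Sg \<A> X"
  by (auto simp: Sg_def)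

lemma Sg_least: "subuniverse \<A> B \<Longrightarrow> X \<subseteq> B \<Longrightarrow> Sg \<A> X \<subseteq> B"
  by (auto simp: Sg_def)

lemma subuniverse_Sg:
  assumes "algebra \<A>" "X \<subseteq> carrier \<A>"
  shows "subuniverse \<A> (Sg \<A> X)"
proof (rule subuniverseI)
  show "Sg \<A> X \<subseteq> carrier \<A>"
    using assms by (intro Sg_least subuniverse_carrier)
next
  fix q f as
  assume f: "(q, f) \<in> set (ops \<A>)" "length as = q" "set as \<subseteq> Sg \<A> X"
  show "f as \<in> Sg \<A> X"
    unfolding Sg_def
  proof (intro InterI)
    fix B assume "B \<in> {B. subuniverse \<A> B \<and> X \<subseteq> B}"
    then have B: "subuniverse \<A> B" "X \<subseteq> B" by auto
    then have "set as \<subseteq> B" using f(3) Sg_least by blast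
    then show "f as \<in> B" using subuniverseD[OF B(1) f(1,2)] by simp
  qed
qed

text \<open>This is the absorption condition that the algorithm checks on the tables. That
  \<open>C\<close> is a subuniverse follows from it, see
  \<open>op_blocker_subuniverse\<close>.\<close>

definition op_blocker :: "'a alg \<Rightarrow> 'a set \<Rightarrow> 'a set \<Rightarrow> bool" where
  "op_blocker \<A> C D \<longleftrightarrow> C \<noteq> {} \<and> C \<subset> D \<and> subuniverse \<A> D \<and>
     (\<forall>(q, f) \<in> set (ops \<A>). \<exists>j<q. \<forall>as. length as = q \<and> set as \<subseteq> D \<and> as ! j \<in> C \<longrightarrow> f as \<in> C)"

lemma op_blockerE:
  assumes "op_blocker \<A> C D" "(q, f) \<in> set (ops \<A>)"
  obtains j where "j < q" "\<And>as. length as = q \<Longrightarrow> set as \<subseteq> D \<Longrightarrow> as ! j \<in> C \<Longrightarrow> f as \<in> C"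
  using assms unfolding op_blocker_def by fast

lemma op_blockerI:
  assumes "C \<noteq> {}" "C \<subset> D" "subuniverse \<A> D"
    and "\<And>q f. (q, f) \<in> set (ops \<A>) \<Longrightarrow>
      \<exists>j<q. \<forall>as. length as = q \<and> set as \<subseteq> D \<and> as ! j \<in> C \<longrightarrow> f as \<in> C"
  shows "op_blocker \<A> C D"
  using assms unfolding op_blocker_def by fast

lemma op_blockerD:
  assumes "op_blocker \<A> C D"
  shows "C \<noteq> {}" "C \<subset> D" "subuniverse \<A> D"
  using assms by (auto simp: op_blocker_def)

lemma op_blocker_subuniverse:
  assumes "op_blocker \<A> C D"
  shows "subuniverse \<A> C"
proof (rule subuniverseI)
  show "C \<subseteq> carrier \<A>"
    using op_blockerD[OF assms] subuniverse_subset by blast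
next
  fix q f as
  assume f: "(q, f) \<in> set (ops \<A>)" "length as = q" "set as \<subseteq> C"
  obtain j where j: "j < q" "\<And>as. length as = q \<Longrightarrow> set as \<subseteq> D \<Longrightarrow> as ! j \<in> C \<Longrightarrow> f as \<in> C"
    using op_blockerE[OF assms f(1)] by metis
  have "as ! j \<in> C" using f j(1) nth_mem by blast
  then show "f as \<in> C" using j(2)[of as] f op_blockerD(2)[OF assms] by blast
qed

text \<open>The coordinate that absorbs \<open>C\<close> in \<open>D\<close> also absorbs
  \<open>C \<inter> E\<close> in \<open>D \<inter> E\<close>, as \<open>E\<close> is closed. This
  serves to fix a coordinate in a power and to cut a given blocker down to
  \<open>Sg(c,d)\<close>.\<close>

lemma op_blocker_restrict:
  assumes blk: "op_blocker \<A> C D" and E: "subuniverse \<A> E" and ne: "C \<inter> E \<noteq> {}" "\<not> E \<inter> D \<subseteq> C"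
  shows "op_blocker \<A> (C \<inter> E) (D \<inter> E)"
proof (rule op_blockerI)
  show "C \<inter> E \<noteq> {}" by fact
  show "C \<inter> E \<subset> D \<inter> E" using op_blockerD(2)[OF blk] ne by blast
  show "subuniverse \<A> (D \<inter> E)" using op_blockerD(3)[OF blk] E by (rule subuniverse_Int)
next
  fix q f assume f: "(q, f) \<in> set (ops \<A>)"
  obtain j where j: "j < q" "\<And>as. length as = q \<Longrightarrow> set as \<subseteq> D \<Longrightarrow> as ! j \<in> C \<Longrightarrow> f as \<in> C"
    using op_blockerE[OF blk f] by metis
  then show "\<exists>j<q. \<forall>as. length as = q \<and> set as \<subseteq> D \<inter> E \<and> as ! j \<in> C \<inter> E \<longrightarrow> f as \<in> C \<inter> E"
    using subuniverseD[OF E f] by (intro exI[of _ j]) auto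
qed

text \<open>Arbitrary index sets are allowed because the cube term is found in the power indexed by
  pairs of elements of \<open>\<A>\<close>; \<open>power_alg\<close> is the case
  \<open>K = {1..n}\<close>.\<close>

definition exp_alg :: "'k set \<Rightarrow> 'a alg \<Rightarrow> ('k \<Rightarrow> 'a) alg" where
  "exp_alg K \<A> =
     \<lparr>carrier = K \<rightarrow>\<^sub>E carrier \<A>,
      ops = map (\<lambda>(q, f). (q, \<lambda>rs. \<lambda>k\<in>K. f (map (\<lambda>r. r k) rs))) (ops \<A>)\<rparr>"

lemma power_alg_eq_exp_alg: "power_alg n \<A> = exp_alg {1..n} \<A>"
  by (simp add: power_alg_def exp_alg_def)

lemma carrier_exp_alg [simp]: "carrier (exp_alg K \<A>) = K \<rightarrow>\<^sub>E carrier \<A>"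
  by (simp add: exp_alg_def)

lemma ops_exp_algE:
  assumes "(q, F) \<in> set (ops (exp_alg K \<A>))"
  obtains f where "(q, f) \<in> set (ops \<A>)" "F = (\<lambda>rs. \<lambda>k\<in>K. f (map (\<lambda>r. r k) rs))"
  using assms by (auto simp: exp_alg_def)

lemma ops_exp_algI:
  "(q, f) \<in> set (ops \<A>) \<Longrightarrow> (q, \<lambda>rs. \<lambda>k\<in>K. f (map (\<lambda>r. r k) rs)) \<in> set (ops (exp_alg K \<A>))"
  by (force simp: exp_alg_def)

text \<open>A tuple over \<open>D\<close> lies in the relation when some entry is in
  \<open>C\<close>. The tuple at the absorbing argument position has such an entry at some
  \<open>i\<close>, and absorption puts entry \<open>i\<close> of the result into
  \<open>C\<close>.\<close>

lemma op_blocker_imp_cube_term_blocker: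
  assumes blk: "op_blocker \<A> C D"
  shows "cube_term_blocker \<A> C D"
proof -
  have "subuniverse (power_alg n \<A>) (({1..n} \<rightarrow>\<^sub>E D) - ({1..n} \<rightarrow>\<^sub>E (D - C)))" for n
    unfolding power_alg_eq_exp_alg
  proof (rule subuniverseI)
    show "({1..n} \<rightarrow>\<^sub>E D) - ({1..n} \<rightarrow>\<^sub>E (D - C)) \<subseteq> carrier (exp_alg {1..n} \<A>)"
      using subuniverse_subset[OF op_blockerD(3)[OF blk]] by (auto simp: PiE_iff)
  next
    fix q F rs
    assume F: "(q, F) \<in> set (ops (exp_alg {1..n} \<A>))" "length rs = q"
      and rs: "set rs \<subseteq> ({1..n} \<rightarrow>\<^sub>E D) - ({1..n} \<rightarrow>\<^sub>E (D - C))"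
    obtain f where f: "(q, f) \<in> set (ops \<A>)" "F = (\<lambda>rs. \<lambda>k\<in>{1..n}. f (map (\<lambda>r. r k) rs))"
      using ops_exp_algE[OF F(1)] .
    obtain j where j: "j < q" "\<And>as. length as = q \<Longrightarrow> set as \<subseteq> D \<Longrightarrow> as ! j \<in> C \<Longrightarrow> f as \<in> C"
      using op_blockerE[OF blk f(1)] by metis
    have rsD: "r i \<in> D" if "r \<in> set rs" "i \<in> {1..n}" for r i
      using rs that by (auto simp: PiE_iff)
    have "rs ! j \<in> ({1..n} \<rightarrow>\<^sub>E D) - ({1..n} \<rightarrow>\<^sub>E (D - C))"
      using rs F(2) j(1) nth_mem by blast
    then obtain i where i: "i \<in> {1..n}" "(rs ! j) i \<in> C"
      by (auto simp: PiE_iff)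
    have "f (map (\<lambda>r. r i) rs) \<in> C"
      using i F(2) j(1) rsD by (intro j(2)) auto
    moreover have "f (map (\<lambda>r. r k) rs) \<in> D" if "k \<in> {1..n}" for k
      using that F(2) rsD by (intro subuniverseD[OF op_blockerD(3)[OF blk] f(1)]) auto
    ultimately show "F rs \<in> ({1..n} \<rightarrow>\<^sub>E D) - ({1..n} \<rightarrow>\<^sub>E (D - C))"
      using i(1) by (auto simp: f(2) PiE_iff)
  qed
  then show ?thesis
    using op_blockerD[OF blk] op_blocker_subuniverse[OF blk] by (auto simp: cube_term_blocker_def)
qed

text \<open>An idempotent nullary operation equals every element of the algebra, but
  \<open>C \<subset> D\<close> with \<open>C\<close> nonempty provides two different ones.\<close>

lemma arity_pos:
  assumes "idempotent \<A>" "(q, f) \<in> set (ops \<A>)" "C \<subset> D" "C \<noteq> {}" "D \<subseteq> carrier \<A>"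
  shows "q > 0"
proof (rule ccontr)
  assume "\<not> q > 0"
  obtain c d where "c \<in> C" "d \<in> D" "c \<noteq> d" using assms by blast
  moreover have "f [] = a" if "a \<in> carrier \<A>" for a
    using idempotentD[OF assms(1,2)] that \<open>\<not> q > 0\<close> by simp
  ultimately show False using assms by blast
qed

text \<open>If no coordinate of \<open>f\<close> absorbs \<open>C\<close>, the witnesses for the \<open>q\<close> coordinates, written as the
  rows of a matrix, have columns in the cross relation of dimension \<open>q\<close>.\<close>

lemma cube_term_blocker_imp_op_blocker:
  assumes idem: "idempotent \<A>" and blk: "cube_term_blocker \<A> C D"
  shows "op_blocker \<A> C D"
proof (rule op_blockerI)
  show C: "C \<noteq> {}" "C \<subset> D" and D: "subuniverse \<A> D"
    using blk by (auto simp: cube_term_blocker_def)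
  fix q f assume f: "(q, f) \<in> set (ops \<A>)"
  have q: "q > 0" using arity_pos[OF idem f C(2,1) subuniverse_subset[OF D]] .
  show "\<exists>j<q. \<forall>as. length as = q \<and> set as \<subseteq> D \<and> as ! j \<in> C \<longrightarrow> f as \<in> C"
  proof (rule ccontr)
    assume "\<not> ?thesis"
    then obtain w where w: "\<And>j. j < q \<Longrightarrow> length (w j) = q \<and> set (w j) \<subseteq> D \<and> w j ! j \<in> C \<and> f (w j) \<notin> C"
      by metis
    let ?R = "({1..q} \<rightarrow>\<^sub>E D) - ({1..q} \<rightarrow>\<^sub>E (D - C))"
    \<comment> \<open>Entry \<open>l\<close> of \<open>rs\<close> is column \<open>l\<close> of the
      matrix with rows \<open>w 0, ..., w (q - 1)\<close>; tuples are indexed from 1, hence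
      \<open>i - 1\<close>.\<close>
    define rs where "rs = map (\<lambda>l. \<lambda>i\<in>{1..q}. w (i - 1) ! l) [0..<q]"
    have sub: "subuniverse (exp_alg {1..q} \<A>) ?R"
      using blk q by (simp add: cube_term_blocker_def power_alg_eq_exp_alg)
    have "(\<lambda>i\<in>{1..q}. w (i - 1) ! l) \<in> ?R" if l: "l < q" for l
    proof -
      have "w (i - 1) ! l \<in> D" if "i \<in> {1..q}" for i
      proof -
        have "i - 1 < q" using that by auto
        then show ?thesis using w[of "i - 1"] l by (metis nth_mem subsetD)
      qed
      \<comment> \<open>The diagonal entry \<open>w l ! l\<close>, at index \<open>Suc l\<close>,
        puts column \<open>l\<close> into the relation.\<close>
      moreover have "w (Suc l - 1) ! l \<in> C" "Suc l \<in> {1..q}" using w l by auto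
      then have "(\<lambda>i\<in>{1..q}. w (i - 1) ! l) \<notin> {1..q} \<rightarrow>\<^sub>E (D - C)"
        by (metis DiffE PiE_mem restrict_apply')
      ultimately show ?thesis by simp
    qed
    then have "set rs \<subseteq> ?R"
      unfolding rs_def set_map set_upt by (intro image_subsetI) simp
    then have R: "(\<lambda>k\<in>{1..q}. f (map (\<lambda>r. r k) rs)) \<in> ?R"
      by (intro subuniverseD[OF sub ops_exp_algI[OF f]]) (simp_all add: rs_def)
    \<comment> \<open>Applying \<open>f\<close> to the columns evaluates it on each row, where the
      value avoids \<open>C\<close>.\<close>
    moreover have "f (map (\<lambda>r. r k) rs) \<notin> C" if "k \<in> {1..q}" for k
    proof -
      have k: "k - 1 < q" using that by auto
      have "map (\<lambda>r. r k) rs = w (k - 1)"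
        using w[OF k] that by (intro nth_equalityI) (auto simp: rs_def)
      then show ?thesis using w[OF k] by simp
    qed
    ultimately show False by (auto simp: PiE_iff)
  qed
qed

section \<open>Blockers in powers\<close>

lemma algebra_exp_alg:
  assumes "algebra \<A>"
  shows "algebra (exp_alg K \<A>)"
proof -
  have "F as \<in> carrier (exp_alg K \<A>)"
    if F: "(q, F) \<in> set (ops (exp_alg K \<A>))" "length as = q" "set as \<subseteq> carrier (exp_alg K \<A>)" for q F as
  proof -
    obtain f where f: "(q, f) \<in> set (ops \<A>)" "F = (\<lambda>rs. \<lambda>k\<in>K. f (map (\<lambda>r. r k) rs))"
      using ops_exp_algE[OF F(1)] .
    have "f (map (\<lambda>r. r k) as) \<in> carrier \<A>" if "k \<in> K" for k
      using F that by (intro subuniverseD[OF subuniverse_carrier[OF assms] f(1)]) (auto simp: PiE_iff)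
    then show ?thesis by (auto simp: f(2))
  qed
  then show ?thesis by (fastforce simp: algebra_def)
qed

lemma idempotent_exp_alg:
  assumes "idempotent \<A>"
  shows "idempotent (exp_alg K \<A>)"
proof -
  have "F (replicate q a) = a"
    if F: "(q, F) \<in> set (ops (exp_alg K \<A>))" and a: "a \<in> carrier (exp_alg K \<A>)" for q F a
  proof -
    obtain f where f: "(q, f) \<in> set (ops \<A>)" "F = (\<lambda>rs. \<lambda>k\<in>K. f (map (\<lambda>r. r k) rs))"
      using ops_exp_algE[OF F(1)] .
    have "f (replicate q (a k)) = a k" if "k \<in> K" for k
      using a that by (intro idempotentD[OF assms f(1)]) auto
    then show ?thesis
      using a by (auto simp: f(2) PiE_iff extensional_def restrict_def)
  qed
  then show ?thesis by (fastforce simp: idempotent_def)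
qed

text \<open>Either some projection of the blocker to a coordinate is a blocker, or a coordinate can be
  fixed.\<close>

lemma op_blocker_exp_alg:
  fixes \<A> :: "'a alg" and K :: "'k set"
  assumes alg: "algebra \<A>" and idem: "idempotent \<A>" and fin: "finite K"
    and blk: "op_blocker (exp_alg K \<A>) C D"
  shows "\<exists>C D. op_blocker \<A> C D"
  using blk
\<comment> \<open>The measure counts the coordinates on which \<open>D\<close> is not
  constant.\<close>
proof (induction "card {k \<in> K. \<exists>d\<in>D. \<exists>d'\<in>D. d k \<noteq> d' k}" arbitrary: C D rule: less_induct)
  case less
  note sub = op_blockerD(3)[OF less.prems]
  have Dcar: "D \<subseteq> K \<rightarrow>\<^sub>E carrier \<A>" using subuniverse_subset[OF sub] by simp
  obtain c d where cd: "c \<in> C" "d \<in> D" "d \<notin> C" "c \<in> D"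
    using op_blockerD[OF less.prems] by blast
  obtain k where k: "k \<in> K" "c k \<noteq> d k"
    using cd Dcar by (metis PiE_ext subsetD)
  show ?case
  proof (cases "(\<lambda>d. d k) ` C = (\<lambda>d. d k) ` D")
    case False
    have "op_blocker \<A> ((\<lambda>d. d k) ` C) ((\<lambda>d. d k) ` D)"
    proof (rule op_blockerI)
      show "(\<lambda>d. d k) ` C \<noteq> {}" using cd by auto
      show "(\<lambda>d. d k) ` C \<subset> (\<lambda>d. d k) ` D" using op_blockerD(2)[OF less.prems] False by blast
      have lift: "\<exists>rs. length rs = q \<and> set rs \<subseteq> D \<and> as = map (\<lambda>r. r k) rs"
        if "length as = q" "set as \<subseteq> (\<lambda>d. d k) ` D" for as q
      proof -
        have "\<forall>a\<in>set as. \<exists>r. r \<in> D \<and> r k = a" using that(2) by blast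
        then obtain g where g: "\<And>a. a \<in> set as \<Longrightarrow> g a \<in> D \<and> g a k = a" by metis
        then have "as = map (\<lambda>r. r k) (map g as)" by (simp add: map_idI)
        moreover have "set (map g as) \<subseteq> D" using g by auto
        ultimately show ?thesis using that(1) by (metis length_map)
      qed
      show "subuniverse \<A> ((\<lambda>d. d k) ` D)"
      proof (rule subuniverseI)
        show "(\<lambda>d. d k) ` D \<subseteq> carrier \<A>" using Dcar k by auto
        fix q f as
        assume f: "(q, f) \<in> set (ops \<A>)" "length as = q" "set as \<subseteq> (\<lambda>d. d k) ` D"
        obtain rs where rs: "length rs = q" "set rs \<subseteq> D" "as = map (\<lambda>r. r k) rs"
          using lift[OF f(2,3)] by blast
        have "(\<lambda>k\<in>K. f (map (\<lambda>r. r k) rs)) \<in> D"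
          using subuniverseD[OF sub ops_exp_algI[OF f(1)] rs(1,2)] .
        then show "f as \<in> (\<lambda>d. d k) ` D"
          using k rs(3) by (intro image_eqI[of _ _ "\<lambda>k\<in>K. f (map (\<lambda>r. r k) rs)"]) simp_all
      qed
      fix q f assume f: "(q, f) \<in> set (ops \<A>)"
      obtain j where j: "j < q" "\<And>rs. length rs = q \<Longrightarrow> set rs \<subseteq> D \<Longrightarrow> rs ! j \<in> C \<Longrightarrow>
          (\<lambda>k\<in>K. f (map (\<lambda>r. r k) rs)) \<in> C"
        using op_blockerE[OF less.prems ops_exp_algI[OF f]] by metis
      have "f as \<in> (\<lambda>d. d k) ` C"
        if as: "length as = q" "set as \<subseteq> (\<lambda>d. d k) ` D" "as ! j \<in> (\<lambda>d. d k) ` C" for as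
      proof -
        obtain rs where rs: "length rs = q" "set rs \<subseteq> D" "as = map (\<lambda>r. r k) rs"
          using lift[OF as(1,2)] by blast
        obtain e where e: "e \<in> C" "as ! j = e k" using as(3) by auto
        have e': "e \<in> D" using e op_blockerD(2)[OF less.prems] by auto
        \<comment> \<open>\<open>lift\<close> only yields preimages in \<open>D\<close>; the one at
          the absorbing position \<open>j\<close> is exchanged for a preimage in
          \<open>C\<close>.\<close>
        let ?rs = "rs[j := e]"
        have "as = map (\<lambda>r. r k) ?rs"
          using rs j(1) e(2) list_update_id[of "map (\<lambda>r. r k) rs" j] by (simp add: map_update)
        moreover have "(\<lambda>k\<in>K. f (map (\<lambda>r. r k) ?rs)) \<in> C"
          using rs e e' j(1) set_update_subset_insert[of rs j e] by (intro j(2)) auto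
        ultimately show ?thesis
          using k by (intro image_eqI[of _ _ "\<lambda>k\<in>K. f (map (\<lambda>r. r k) ?rs)"]) simp_all
      qed
      then show "\<exists>j<q. \<forall>as. length as = q \<and> set as \<subseteq> (\<lambda>d. d k) ` D \<and> as ! j \<in> (\<lambda>d. d k) ` C \<longrightarrow>
          f as \<in> (\<lambda>d. d k) ` C"
        using j(1) by blast
    qed
    then show ?thesis by blast
  next
    case True
    \<comment> \<open>The fibre over \<open>d k\<close>, a subuniverse by idempotence. It contains
      \<open>d \<notin> C\<close>, and it meets \<open>C\<close> because \<open>C\<close> and
      \<open>D\<close> have the same projection to \<open>k\<close>.\<close>
    let ?E = "{e \<in> K \<rightarrow>\<^sub>E carrier \<A>. e k = d k}"
    have dk: "d k \<in> carrier \<A>" using cd Dcar k by auto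
    have E: "subuniverse (exp_alg K \<A>) ?E"
    proof (rule subuniverseI)
      show "?E \<subseteq> carrier (exp_alg K \<A>)" by auto
      fix q F rs
      assume F: "(q, F) \<in> set (ops (exp_alg K \<A>))" "length rs = q" "set rs \<subseteq> ?E"
      obtain f where f: "(q, f) \<in> set (ops \<A>)" "F = (\<lambda>rs. \<lambda>k\<in>K. f (map (\<lambda>r. r k) rs))"
        using ops_exp_algE[OF F(1)] .
      have *: "F rs k = d k"
        using F k dk by (auto simp: f(2) intro!: idempotentD[OF idem f(1)])
      have "F rs \<in> carrier (exp_alg K \<A>)"
        using F(3) by (intro subuniverseD[OF subuniverse_carrier[OF algebra_exp_alg[OF alg]] F(1,2)]) auto
      with * show "F rs \<in> ?E" by simp
    qed
    have "d k \<in> (\<lambda>d. d k) ` C" unfolding True using cd(2) by (rule imageI)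
    then obtain e where e: "e \<in> C" "e k = d k" by (metis imageE)
    have "e \<in> C \<inter> ?E" "d \<in> ?E \<inter> D"
      using e cd Dcar op_blockerD(2)[OF less.prems] by blast+
    then have "op_blocker (exp_alg K \<A>) (C \<inter> ?E) (D \<inter> ?E)"
      using cd(3) by (intro op_blocker_restrict[OF less.prems E]) blast+
    moreover have "card {l \<in> K. \<exists>d\<in>D \<inter> ?E. \<exists>d'\<in>D \<inter> ?E. d l \<noteq> d' l}
        < card {l \<in> K. \<exists>d\<in>D. \<exists>d'\<in>D. d l \<noteq> d' l}"
    proof (rule psubset_card_mono)
      \<comment> \<open>Coordinate \<open>k\<close> separates \<open>c\<close> and \<open>d\<close>
        in \<open>D\<close> but is constant on \<open>?E\<close>, so the measure drops.\<close>
      have "k \<in> {l \<in> K. \<exists>d\<in>D. \<exists>d'\<in>D. d l \<noteq> d' l}" using k cd by blast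
      moreover have "k \<notin> {l \<in> K. \<exists>d\<in>D \<inter> ?E. \<exists>d'\<in>D \<inter> ?E. d l \<noteq> d' l}" by simp
      ultimately show "{l \<in> K. \<exists>d\<in>D \<inter> ?E. \<exists>d'\<in>D \<inter> ?E. d l \<noteq> d' l}
          \<subset> {l \<in> K. \<exists>d\<in>D. \<exists>d'\<in>D. d l \<noteq> d' l}"
        by blast
    qed (use fin in simp)
    ultimately show ?thesis using less.hyps by blast
  qed
qed

section \<open>A cross avoiding a constant sequence\<close>

text \<open>The operations act entrywise. Sequences are infinite so that infinitely many places
  remain free after freezing finitely many, and they are plain functions so that reindexing is
  composition.\<close>

inductive seq_gen :: "'b alg \<Rightarrow> (nat \<Rightarrow> 'b) set \<Rightarrow> (nat \<Rightarrow> 'b) \<Rightarrow> bool"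
  for \<B> :: "'b alg" and G :: "(nat \<Rightarrow> 'b) set" where
  base: "z \<in> G \<Longrightarrow> seq_gen \<B> G z"
| app: "(q, f) \<in> set (ops \<B>) \<Longrightarrow> length zs = q \<Longrightarrow> (\<And>z. z \<in> set zs \<Longrightarrow> seq_gen \<B> G z)
    \<Longrightarrow> seq_gen \<B> G (\<lambda>i. f (map (\<lambda>z. z i) zs))"

definition cross :: "'b set \<Rightarrow> 'b set \<Rightarrow> (nat \<Rightarrow> 'b) set" where
  "cross D C = {z. range z \<subseteq> D \<and> (\<exists>i. z i \<in> C)}"

lemma seq_gen_range:
  assumes "subuniverse \<B> D" "seq_gen \<B> (cross D C) z"
  shows "z i \<in> D"
  using assms(2)
proof induction
  case (base z)
  then show ?case by (auto simp: cross_def)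
next
  case (app q f zs)
  show ?case using app by (intro subuniverseD[OF assms(1) app(1)]) auto
qed

text \<open>Reindexing by a surjection still hits an entry in \<open>C\<close>, so it maps
  generators to generators, and it commutes with the entrywise operations.\<close>

lemma seq_gen_perm:
  assumes "surj \<tau>" "seq_gen \<B> (cross D C) z"
  shows "seq_gen \<B> (cross D C) (\<lambda>i. z (\<tau> i))"
  using assms(2)
proof induction
  case (base z)
  then obtain i where "range z \<subseteq> D" "z i \<in> C" by (auto simp: cross_def)
  moreover obtain j where "i = \<tau> j" using assms(1) by (metis surjD)
  ultimately have "(\<lambda>i. z (\<tau> i)) \<in> cross D C" by (auto simp: cross_def)
  then show ?case by (rule seq_gen.base)
next
  case (app q f zs)
  have "seq_gen \<B> (cross D C) (\<lambda>i. f (map (\<lambda>z. z i) (map (\<lambda>z i. z (\<tau> i)) zs)))"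
    using app by (intro seq_gen.app[OF app(1)]) auto
  then show ?case by (simp add: comp_def)
qed

text \<open>A generator owes its membership to a single entry in \<open>C\<close>, and a derivation
  uses finitely many generators. Changes at the other places can be made in all generators at once
  and pass through the operations by idempotence.\<close>

lemma seq_gen_local:
  assumes sub: "subuniverse \<B> D" and idem: "idempotent \<B>" and "seq_gen \<B> (cross D C) z"
  shows "\<exists>M. finite M \<and> (\<forall>w. range w \<subseteq> D \<longrightarrow> (\<forall>i\<in>M. w i = z i) \<longrightarrow> seq_gen \<B> (cross D C) w)"
  using assms(3)
proof induction
  case (base z)
  then obtain i where "range z \<subseteq> D" "z i \<in> C" by (auto simp: cross_def)
  then show ?case
    by (intro exI[of _ "{i}"]) (auto simp: cross_def intro!: seq_gen.base intro: exI[of _ i])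
next
  case (app q f zs)
  have "\<forall>z\<in>set zs. \<exists>M. finite M \<and>
      (\<forall>w. range w \<subseteq> D \<longrightarrow> (\<forall>i\<in>M. w i = z i) \<longrightarrow> seq_gen \<B> (cross D C) w)"
    using app by blast
  then obtain M where M: "\<And>z. z \<in> set zs \<Longrightarrow> finite (M z)"
    "\<And>z w. z \<in> set zs \<Longrightarrow> range w \<subseteq> D \<Longrightarrow> \<forall>i\<in>M z. w i = z i \<Longrightarrow> seq_gen \<B> (cross D C) w"
    by metis
  let ?M = "\<Union> (M ` set zs)"
  have "seq_gen \<B> (cross D C) w"
    if w: "range w \<subseteq> D" "\<forall>i\<in>?M. w i = f (map (\<lambda>z. z i) zs)" for w
  proof -
    \<comment> \<open>Off \<open>?M\<close> every argument takes the value \<open>w i\<close>, so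
      that idempotence returns \<open>w i\<close> there; on \<open>?M\<close> the arguments are
      unchanged.\<close>
    define g where "g z i = (if i \<in> ?M then z i else w i)" for z i
    have "seq_gen \<B> (cross D C) (g z)" if "z \<in> set zs" for z
    proof (rule M(2)[OF that])
      have "z i \<in> D" for i using seq_gen_range[OF sub] app(3) that by blast
      then show "range (g z) \<subseteq> D" using w by (auto simp: g_def)
      show "\<forall>i\<in>M z. g z i = z i" using that by (auto simp: g_def)
    qed
    then have "seq_gen \<B> (cross D C) (\<lambda>i. f (map (\<lambda>z. z i) (map g zs)))"
      using app(2) by (intro seq_gen.app[OF app(1)]) auto
    moreover have "f (map (\<lambda>z. z i) (map g zs)) = w i" for i
    proof (cases "i \<in> ?M")
      case True
      have "map (\<lambda>z. z i) (map g zs) = map (\<lambda>z. z i) zs" using True by (auto simp: g_def)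
      then show ?thesis using bspec[OF w(2) True] by (simp only:)
    next
      case False
      have "w i \<in> carrier \<B>" using w(1) subuniverse_subset[OF sub] by blast
      then show ?thesis
        using False app(2) by (intro idempotentD[OF idem app(1)]) (auto simp: g_def)
    qed
    ultimately show ?thesis by simp
  qed
  moreover have "finite ?M" using M(1) by blast
  ultimately show ?case by blast
qed

text \<open>Freezing \<open>e\<close> on the finite set \<open>M - {i}\<close> and moving the remaining coordinates there by
  \<open>\<beta>\<close> gives a relation on \<open>D\<close> which, by symmetry, contains the cross of \<open>insert (e i) C\<close>.\<close>

lemma seq_gen_replace:
  assumes sub: "subuniverse \<B> D" and idem: "idempotent \<B>" and x: "x \<in> D"
    and e: "seq_gen \<B> (cross D C) e" "finite {j. e j \<noteq> x}"
    and ext: "seq_gen \<B> (cross D (insert (e i) C)) (\<lambda>_. x)"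
  shows "seq_gen \<B> (cross D C) (e(i := x))"
proof -
  obtain M0 where M0: "finite M0"
    "\<And>w. range w \<subseteq> D \<Longrightarrow> \<forall>i\<in>M0. w i = e i \<Longrightarrow> seq_gen \<B> (cross D C) w"
    using seq_gen_local[OF sub idem e(1)] by blast
  \<comment> \<open>\<open>M\<close> contains the places on which membership of \<open>e\<close>
    depends and those where \<open>e\<close> differs from \<open>x\<close>, except for
    \<open>i\<close>, which is to be replaced.\<close>
  define M where "M = (M0 \<union> {j. e j \<noteq> x}) - {i}"
  have "infinite (- M)" using M0(1) e(2) by (simp add: M_def Compl_eq_Diff_UNIV)
  then have \<beta>: "bij_betw (enumerate (- M)) UNIV (- M)" by (rule bij_enumerate)
  define \<beta> where "\<beta> = enumerate (- M)"
  have \<beta>M: "\<beta> k \<notin> M" and inj: "inj \<beta>" for k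
    using \<beta> by (auto simp: \<beta>_def bij_betw_def)
  define glue where "glue z l = (if l \<in> M then e l else z (inv \<beta> l))" for z l
  have eD: "e j \<in> D" for j using seq_gen_range[OF sub e(1)] .
  have "seq_gen \<B> (cross D C) (glue z)" if "seq_gen \<B> (cross D (insert (e i) C)) z" for z
    using that
  proof induction
    case (base z)
    then obtain k where z: "range z \<subseteq> D" "z k = e i \<or> z k \<in> C" by (auto simp: cross_def)
    have gD: "range (glue z) \<subseteq> D" using z(1) eD by (auto simp: glue_def)
    have gk: "glue z (\<beta> k) = z k" using \<beta>M inj by (simp add: glue_def)
    show ?case
    proof (cases "z k \<in> C")
      case True
      then have "glue z (\<beta> k) \<in> C" using gk by simp
      then have "glue z \<in> cross D C" using gD by (auto simp: cross_def)
      then show ?thesis by (rule seq_gen.base)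
    next
      case False
      \<comment> \<open>Here \<open>z k = e i\<close>. Exchanging \<open>i\<close> and
        \<open>\<beta> k\<close> brings this value to place \<open>i\<close>; the result agrees with
        \<open>e\<close> on \<open>M0\<close>, so locality applies, and symmetry then undoes the
        exchange.\<close>
      define \<tau> where "\<tau> = id(i := \<beta> k, \<beta> k := i)"
      have \<tau>\<tau>: "\<tau> (\<tau> j) = j" for j by (simp add: \<tau>_def)
      have "seq_gen \<B> (cross D C) (\<lambda>j. glue z (\<tau> j))"
      proof (rule M0(2))
        show "range (\<lambda>j. glue z (\<tau> j)) \<subseteq> D" using gD by blast
        show "\<forall>j\<in>M0. glue z (\<tau> j) = e j"
        proof
          fix j assume j: "j \<in> M0"
          show "glue z (\<tau> j) = e j"
          proof (cases "j = i")
            case True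
            then have "\<tau> j = \<beta> k" by (simp add: \<tau>_def)
            then show ?thesis using gk z(2) False True by simp
          next
            case False
            then have "j \<in> M" using j by (simp add: M_def)
            then have "\<tau> j = j" using \<beta>M[of k] False by (auto simp: \<tau>_def)
            then show ?thesis using \<open>j \<in> M\<close> by (simp add: glue_def)
          qed
        qed
      qed
      moreover have "surj \<tau>" by (rule surjI[of \<tau> \<tau>]) (rule \<tau>\<tau>)
      ultimately have "seq_gen \<B> (cross D C) (\<lambda>j. glue z (\<tau> (\<tau> j)))"
        using seq_gen_perm[of \<tau> \<B> D C "\<lambda>j. glue z (\<tau> j)"] by blast
      then show ?thesis by (simp only: \<tau>\<tau>)
    qed
  next
    case (app q f zs)
    have "seq_gen \<B> (cross D C) (\<lambda>l. f (map (\<lambda>z. z l) (map glue zs)))"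
      using app by (intro seq_gen.app[OF app(1)]) auto
    moreover have "f (map (\<lambda>z. z l) (map glue zs)) = glue (\<lambda>i. f (map (\<lambda>z. z i) zs)) l" for l
    proof (cases "l \<in> M")
      case True
      \<comment> \<open>On \<open>M\<close> all arguments are \<open>e l\<close>, which idempotence
        preserves.\<close>
      have "e l \<in> carrier \<B>" using eD subuniverse_subset[OF sub] by blast
      then show ?thesis
        using True app(2) by (subst idempotentD[OF idem app(1)]) (auto simp: glue_def)
    next
      case False
      then show ?thesis by (simp add: glue_def comp_def)
    qed
    ultimately show ?case by simp
  qed
  from this[OF ext] have "seq_gen \<B> (cross D C) (glue (\<lambda>_. x))" .
  \<comment> \<open>Off \<open>M\<close> the sequence \<open>e\<close> is \<open>x\<close>
    everywhere except possibly at \<open>i\<close>.\<close>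
  moreover have "glue (\<lambda>_. x) = e(i := x)" by (auto simp: glue_def M_def fun_eq_iff)
  ultimately show ?thesis by simp
qed

text \<open>Locality turns all but finitely many entries of \<open>e\<close> into \<open>x\<close>.
  If none of the remaining ones lay in \<open>C\<close>, maximality and
  \<open>seq_gen_replace\<close> would allow each of them to be replaced by \<open>x\<close>,
  against the assumption on the constant sequence.\<close>

lemma seq_gen_maximal_cross:
  assumes sub: "subuniverse \<B> D" and idem: "idempotent \<B>" and x: "x \<in> D"
    and avoid: "\<not> seq_gen \<B> (cross D C) (\<lambda>_. x)"
    and maximal: "\<And>a. a \<in> D \<Longrightarrow> a \<notin> C \<Longrightarrow> seq_gen \<B> (cross D (insert a C)) (\<lambda>_. x)"
    and e: "seq_gen \<B> (cross D C) e"
  shows "\<exists>i. e i \<in> C"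
proof (rule ccontr)
  assume nC: "\<nexists>i. e i \<in> C"
  have xC: "x \<notin> C" using avoid x by (auto simp: cross_def intro!: seq_gen.base)
  obtain M where M: "finite M"
    "\<And>w. range w \<subseteq> D \<Longrightarrow> \<forall>i\<in>M. w i = e i \<Longrightarrow> seq_gen \<B> (cross D C) w"
    using seq_gen_local[OF sub idem e] by blast
  define z where "z i = (if i \<in> M then e i else x)" for i
  have "e i \<in> D" for i using seq_gen_range[OF sub e] .
  then have "seq_gen \<B> (cross D C) z" using x by (intro M(2)) (auto simp: z_def)
  moreover have "finite {j. z j \<noteq> x}" by (rule finite_subset[OF _ M(1)]) (auto simp: z_def)
  moreover have "z i \<notin> C" for i using nC xC by (simp add: z_def)
  ultimately have "seq_gen \<B> (cross D C) (\<lambda>_. x)"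
  \<comment> \<open>Replacing one entry reduces the number of entries different from
    \<open>x\<close>, and no entry enters \<open>C\<close> because
    \<open>x \<notin> C\<close>.\<close>
  proof (induction "card {j. z j \<noteq> x}" arbitrary: z rule: less_induct)
    case less
    show ?case
    proof (cases "\<exists>i. z i \<noteq> x")
      case False
      then have "z = (\<lambda>_. x)" by auto
      then show ?thesis using less.prems(1) by simp
    next
      case True
      then obtain i where i: "z i \<noteq> x" by blast
      have "z i \<in> D" using seq_gen_range[OF sub less.prems(1)] .
      then have g: "seq_gen \<B> (cross D C) (z(i := x))"
        by (intro seq_gen_replace[OF sub idem x less.prems(1,2)] maximal less.prems(3))
      have s: "{j. (z(i := x)) j \<noteq> x} \<subset> {j. z j \<noteq> x}" using i by auto
      show ?thesis
        using psubset_card_mono[OF less.prems(2) s] finite_subset[OF psubset_imp_subset[OF s] less.prems(2)] g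
          less.prems(3) xC
        by (intro less.hyps[of "z(i := x)"]) auto
    qed
  qed
  with avoid show False by simp
qed

lemma op_blocker_or_seq_gen:
  assumes sub: "subuniverse \<B> D" and idem: "idempotent \<B>" and fin: "finite D"
    and xy: "x \<in> D" "y \<in> D"
  shows "(\<exists>C. op_blocker \<B> C D) \<or> seq_gen \<B> (cross D {y}) (\<lambda>_. x)"
proof (rule disjCI)
  assume ng: "\<not> seq_gen \<B> (cross D {y}) (\<lambda>_. x)"
  \<comment> \<open>Requiring \<open>y \<in> C\<close> keeps the members nonempty;
    \<open>{y}\<close> is a member, and finiteness of \<open>D\<close> gives a maximal one.\<close>
  define \<G> where "\<G> = {C. C \<subseteq> D \<and> y \<in> C \<and> \<not> seq_gen \<B> (cross D C) (\<lambda>_. x)}"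
  have "finite \<G>" by (rule finite_subset[of _ "Pow D"]) (use fin in \<open>auto simp: \<G>_def\<close>)
  moreover have "{y} \<in> \<G>" using ng xy by (simp add: \<G>_def)
  ultimately obtain C where C: "C \<in> \<G>" "\<And>C'. C' \<in> \<G> \<Longrightarrow> C \<subseteq> C' \<Longrightarrow> C = C'"
    by (metis finite_has_maximal2)
  have avoid: "\<not> seq_gen \<B> (cross D C) (\<lambda>_. x)" and CD: "C \<subseteq> D" "y \<in> C"
    using C(1) by (auto simp: \<G>_def)
  have maximal: "seq_gen \<B> (cross D (insert a C)) (\<lambda>_. x)" if "a \<in> D" "a \<notin> C" for a
  proof (rule ccontr)
    assume "\<not> ?thesis"
    then have "insert a C \<in> \<G>" using CD that by (simp add: \<G>_def)
    then show False using C(2)[of "insert a C"] that by blast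
  qed
  \<comment> \<open>With \<open>x\<close> in \<open>C\<close> the constant sequence would itself be
    a generator.\<close>
  have xC: "x \<notin> C" using avoid xy by (auto simp: cross_def intro!: seq_gen.base)
  then have CD': "C \<subset> D" using CD xy by blast
  have "op_blocker \<B> C D"
  proof (rule op_blockerI)
    show "C \<noteq> {}" using CD by blast
    show "C \<subset> D" "subuniverse \<B> D" by fact+
    fix q f assume f: "(q, f) \<in> set (ops \<B>)"
    have q: "q > 0"
      using arity_pos[OF idem f CD' _ subuniverse_subset[OF sub]] CD by blast
    show "\<exists>j<q. \<forall>as. length as = q \<and> set as \<subseteq> D \<and> as ! j \<in> C \<longrightarrow> f as \<in> C"
    proof (rule ccontr)
      assume "\<not> ?thesis"
      then obtain w where w: "\<And>j. j < q \<Longrightarrow> length (w j) = q \<and> set (w j) \<subseteq> D \<and> w j ! j \<in> C \<and> f (w j) \<notin> C"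
        by metis
      \<comment> \<open>The rows \<open>w 0, ..., w (q - 1)\<close> are continued by copies of
        \<open>w 0\<close> to make every column an infinite sequence; the diagonal again supplies
        entries in \<open>C\<close>.\<close>
      define r where "r i = (if i < q then i else 0)" for i
      have r: "r i < q" for i using q by (simp add: r_def)
      define zs where "zs = map (\<lambda>l i. w (r i) ! l) [0..<q]"
      have "seq_gen \<B> (cross D C) (\<lambda>i. w (r i) ! l)" if l: "l < q" for l
      proof (rule seq_gen.base)
        have "w (r i) ! l \<in> D" for i using w[OF r[of i]] l by (metis nth_mem subsetD)
        moreover have "w (r l) ! l \<in> C" using w l by (simp add: r_def)
        ultimately show "(\<lambda>i. w (r i) ! l) \<in> cross D C" by (auto simp: cross_def)
      qed
      then have "seq_gen \<B> (cross D C) (\<lambda>i. f (map (\<lambda>z. z i) zs))"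
        by (intro seq_gen.app[OF f]) (auto simp: zs_def)
      moreover have "map (\<lambda>z. z i) zs = w (r i)" for i
        using w[OF r[of i]] by (intro nth_equalityI) (auto simp: zs_def)
      ultimately have "\<exists>i. f (w (r i)) \<in> C"
        using seq_gen_maximal_cross[OF sub idem xy(1) avoid maximal] by simp
      then show False using w r by blast
    qed
  qed
  then show "\<exists>C. op_blocker \<B> C D" by blast
qed

section \<open>Cube terms from the absence of blockers\<close>

text \<open>The argument with index \<open>I\<close> stands for the sequence with \<open>y\<close>
  at the places \<open>i\<close> with \<open>Suc i \<in> I\<close> and \<open>x\<close> elsewhere.
  So one term produces the first \<open>n\<close> entries of \<open>z\<close> from the sequences
  over \<open>{x, y}\<close> with a \<open>y\<close> among these entries. The shift by one matches
  the numbering in \<open>cube_term\<close>; later entries are unconstrained.\<close>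

definition term_values ::
  "'a alg \<Rightarrow> 'k set \<Rightarrow> ('k \<Rightarrow> 'a) \<Rightarrow> ('k \<Rightarrow> 'a) \<Rightarrow> nat \<Rightarrow> (nat \<Rightarrow> 'k \<Rightarrow> 'a) set" where
  "term_values \<A> K x y n = {z. \<exists>t. term_op \<A> (Pow {1..n} - {{}}) t \<and>
     (\<forall>i<n. \<forall>k\<in>K. z i k = t (\<lambda>I. if Suc i \<in> I then y k else x k))}"

lemma term_values_closed:
  assumes F: "(q, F) \<in> set (ops (exp_alg K \<A>))" "length zs = q" "set zs \<subseteq> term_values \<A> K x y n"
  shows "(\<lambda>i. F (map (\<lambda>z. z i) zs)) \<in> term_values \<A> K x y n"
proof -
  obtain f where f: "(q, f) \<in> set (ops \<A>)" "F = (\<lambda>rs. \<lambda>k\<in>K. f (map (\<lambda>r. r k) rs))"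
    using ops_exp_algE[OF F(1)] .
  have "\<forall>z\<in>set zs. \<exists>t. term_op \<A> (Pow {1..n} - {{}}) t \<and>
      (\<forall>i<n. \<forall>k\<in>K. z i k = t (\<lambda>I. if Suc i \<in> I then y k else x k))"
    using F(3) unfolding term_values_def by blast
  then obtain t where t: "\<And>z. z \<in> set zs \<Longrightarrow> term_op \<A> (Pow {1..n} - {{}}) (t z)"
    "\<And>z i k. z \<in> set zs \<Longrightarrow> i < n \<Longrightarrow> k \<in> K \<Longrightarrow> z i k = t z (\<lambda>I. if Suc i \<in> I then y k else x k)"
    by metis
  have "term_op \<A> (Pow {1..n} - {{}}) (\<lambda>v. f (map (\<lambda>t. t v) (map t zs)))"
    using t(1) F(2) by (intro term_op.app[OF f(1)]) auto
  moreover have "F (map (\<lambda>z. z i) zs) k = f (map (\<lambda>t. t (\<lambda>I. if Suc i \<in> I then y k else x k)) (map t zs))"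
    if "i < n" "k \<in> K" for i k
    using t(2)[OF _ that] that(2) by (auto simp: f(2) comp_def intro!: arg_cong[of _ _ f])
  ultimately show ?thesis unfolding term_values_def by blast
qed

lemma term_values_cong:
  assumes "z \<in> term_values \<A> K x y n" "\<And>i k. i < n \<Longrightarrow> k \<in> K \<Longrightarrow> w i k = z i k"
  shows "w \<in> term_values \<A> K x y n"
proof -
  obtain t where "term_op \<A> (Pow {1..n} - {{}}) t"
    "\<And>i k. i < n \<Longrightarrow> k \<in> K \<Longrightarrow> z i k = t (\<lambda>I. if Suc i \<in> I then y k else x k)"
    using assms(1) unfolding term_values_def by blast
  then show ?thesis
    using assms(2) unfolding term_values_def by (intro CollectI exI[of _ t]) simp
qed

text \<open>Entries outside \<open>{x, y}\<close> are treated one at a time. With the others fixed,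
  the values admissible at one place form a subuniverse by idempotence; it contains \<open>x\<close>
  and \<open>y\<close>, hence all that they generate.\<close>

lemma term_values_cross:
  assumes alg: "algebra \<A>" and idem: "idempotent \<A>"
    and xy: "x \<in> K \<rightarrow>\<^sub>E carrier \<A>" "y \<in> K \<rightarrow>\<^sub>E carrier \<A>"
    and z: "\<And>i. z i \<in> Sg (exp_alg K \<A>) {x, y}" "z i0 = y" "i0 < n"
  shows "z \<in> term_values \<A> K x y n"
proof -
  let ?B = "exp_alg K \<A>"
  let ?D = "Sg ?B {x, y}"
  have D: "subuniverse ?B ?D" using alg xy by (intro subuniverse_Sg algebra_exp_alg) auto
  have xyD: "x \<in> ?D" "y \<in> ?D" using Sg_superset[of "{x, y}" ?B] by auto
  have "z \<in> term_values \<A> K x y n"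
    if "finite M" "\<And>j. z j \<in> ?D" "\<And>j. j \<notin> M \<Longrightarrow> z j \<in> {x, y}" "\<exists>i<n. z i = y" for M z
    using that
  proof (induction M arbitrary: z rule: finite_induct)
    case empty
    \<comment> \<open>With entries \<open>x\<close> and \<open>y\<close> only, \<open>z\<close> is
      itself one of the arguments, so a projection suffices; \<open>?I\<close> is nonempty because
      \<open>y\<close> occurs before \<open>n\<close>.\<close>
    let ?I = "{Suc j | j. j < n \<and> z j = y}"
    have "term_op \<A> (Pow {1..n} - {{}}) (\<lambda>v. v ?I)"
      using empty.prems(3) by (intro term_op.proj) auto
    moreover have "z i k = (if Suc i \<in> ?I then y k else x k)" if "i < n" for i k
      using empty.prems(2)[of i] that by auto
    ultimately show ?case unfolding term_values_def by blast
  next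
    case (insert m M)
    show ?case
    proof (cases "z m = y")
      case True
      show ?thesis
      proof (rule insert.IH)
        show "z j \<in> {x, y}" if "j \<notin> M" for j
          using insert.prems(2)[of j] that True by (cases "j = m") auto
      qed (use insert.prems in auto)
    next
      case False
      let ?E = "{e \<in> carrier ?B. z(m := e) \<in> term_values \<A> K x y n}"
      have "subuniverse ?B ?E"
      proof (rule subuniverseI)
        show "?E \<subseteq> carrier ?B" by blast
        fix q F as assume F: "(q, F) \<in> set (ops ?B)" "length as = q" "set as \<subseteq> ?E"
        have "(\<lambda>i. F (map (\<lambda>z. z i) (map (\<lambda>e. z(m := e)) as))) \<in> term_values \<A> K x y n"
          using F by (intro term_values_closed[OF F(1)]) auto
        moreover have "(\<lambda>i. F (map (\<lambda>z. z i) (map (\<lambda>e. z(m := e)) as))) = z(m := F as)"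
        proof
          fix i
          have "z i \<in> carrier ?B" using insert.prems(1) subuniverse_subset[OF D] by blast
          then have "F (map (\<lambda>_. z i) as) = z i"
            using F(2) by (intro idempotentD[OF idempotent_exp_alg[OF idem] F(1)]) auto
          then show "F (map (\<lambda>z. z i) (map (\<lambda>e. z(m := e)) as)) = (z(m := F as)) i"
            by (simp add: comp_def)
        qed
        moreover have "F as \<in> carrier ?B"
          using F(3) by (intro subuniverseD[OF subuniverse_carrier[OF algebra_exp_alg[OF alg]] F(1,2)]) auto
        ultimately show "F as \<in> ?E" by simp
      qed
      moreover have "z(m := e) \<in> term_values \<A> K x y n" if "e \<in> {x, y}" for e
      proof (rule insert.IH)
        show "(z(m := e)) j \<in> ?D" for j using insert.prems(1) that xyD by auto
        show "(z(m := e)) j \<in> {x, y}" if "j \<notin> M" for j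
          using insert.prems(2)[of j] that \<open>e \<in> {x, y}\<close> by auto
        show "\<exists>i<n. (z(m := e)) i = y" using insert.prems(3) False by auto
      qed
      then have "{x, y} \<subseteq> ?E" using xy by auto
      ultimately have "?D \<subseteq> ?E" by (rule Sg_least)
      then have "z(m := z m) \<in> term_values \<A> K x y n" using insert.prems(1) by blast
      then show ?thesis by simp
    qed
  qed
  note induct = this
  \<comment> \<open>Entries from \<open>n\<close> on do not affect membership in
    \<open>term_values\<close>; setting them to \<open>y\<close> leaves only finitely many
    exceptional places.\<close>
  have "(\<lambda>i. if i < n then z i else y) \<in> term_values \<A> K x y n"
  proof (rule induct[of "{..<n}"])
    show "\<exists>i<n. (if i < n then z i else y) = y" using z by auto
  qed (use z(1) xyD in auto)
  then show ?thesis by (rule term_values_cong) simp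
qed

lemma no_op_blocker_imp_cube_term:
  fixes \<A> :: "'a alg"
  assumes alg: "algebra \<A>" and idem: "idempotent \<A>" and fin: "finite (carrier \<A>)"
    and no: "\<nexists>C D. op_blocker \<A> C D"
  shows "has_cube_term \<A>"
proof -
  \<comment> \<open>Indexing by all pairs makes the projections \<open>x\<close> and
    \<open>y\<close> a generic pair: an identity satisfied by them holds for all pairs of elements
    of \<open>\<A>\<close>.\<close>
  define K where "K = carrier \<A> \<times> carrier \<A>"
  define x y where "x = restrict fst K" and "y = restrict snd K"
  let ?B = "exp_alg K \<A>"
  let ?D = "Sg ?B {x, y}"
  have K: "finite K" using fin by (simp add: K_def)
  have xy: "x \<in> K \<rightarrow>\<^sub>E carrier \<A>" "y \<in> K \<rightarrow>\<^sub>E carrier \<A>" by (auto simp: x_def y_def K_def)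
  have D: "subuniverse ?B ?D" using alg xy by (intro subuniverse_Sg algebra_exp_alg) auto
  have xyD: "x \<in> ?D" "y \<in> ?D" using Sg_superset[of "{x, y}" ?B] by auto
  have "finite ?D"
    using K fin by (intro finite_subset[OF subuniverse_subset[OF D]]) (simp add: finite_PiE)
  then have gen: "seq_gen ?B (cross ?D {y}) (\<lambda>_. x)"
    using op_blocker_or_seq_gen[OF D idempotent_exp_alg[OF idem] _ xyD]
      op_blocker_exp_alg[OF alg idem K] no by blast
  have "\<forall>\<^sub>F n in sequentially. z \<in> term_values \<A> K x y n" if "seq_gen ?B (cross ?D {y}) z" for z
    using that
  \<comment> \<open>A generator is a term value as soon as \<open>n\<close> exceeds the place of an
    entry \<open>y\<close>; a derivation uses finitely many generators, so one large
    \<open>n\<close> serves them all.\<close>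
  proof induction
    case (base z)
    then obtain i where i: "range z \<subseteq> ?D" "z i = y" by (auto simp: cross_def)
    then have "z \<in> term_values \<A> K x y n" if "n > i" for n
      using that by (intro term_values_cross[OF alg idem xy]) auto
    then show ?case using eventually_gt_at_top by (rule eventually_mono[rotated])
  next
    case (app q F zs)
    then have "\<forall>\<^sub>F n in sequentially. \<forall>z\<in>set zs. z \<in> term_values \<A> K x y n"
      by (intro eventually_ball_finite) auto
    then show ?case
      by eventually_elim (use app in \<open>auto intro!: term_values_closed\<close>)
  qed
  from eventually_conj[OF this[OF gen] eventually_ge_at_top[of 1]]
  obtain n where n: "(\<lambda>_. x) \<in> term_values \<A> K x y n" "n \<ge> 1"
    by (auto dest!: eventually_happens)
  then obtain t where t: "term_op \<A> (Pow {1..n} - {{}}) t"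
    "\<And>i k. i < n \<Longrightarrow> k \<in> K \<Longrightarrow> x k = t (\<lambda>I. if Suc i \<in> I then y k else x k)"
    unfolding term_values_def by blast
  have "t (\<lambda>I. chi I a b i) = a i"
    if "a \<in> {1..n} \<rightarrow>\<^sub>E carrier \<A>" "b \<in> {1..n} \<rightarrow>\<^sub>E carrier \<A>" "i \<in> {1..n}" for a b i
  proof -
    \<comment> \<open>Evaluation at this pair turns \<open>x\<close> and \<open>y\<close> into
      \<open>a i\<close> and \<open>b i\<close>.\<close>
    have k: "(a i, b i) \<in> K" using that by (auto simp: K_def)
    have "i - 1 < n" "Suc (i - 1) = i" using that(3) by auto
    then have "a i = t (\<lambda>I. if i \<in> I then y (a i, b i) else x (a i, b i))"
      using t(2)[of "i - 1", OF _ k] k by (simp add: x_def)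
    also have "(\<lambda>I. if i \<in> I then y (a i, b i) else x (a i, b i)) = (\<lambda>I. chi I a b i)"
      using k by (auto simp: x_def y_def chi_def)
    finally show ?thesis by (rule sym)
  qed
  then have "cube_term \<A> n t" using t(1) n(2) by (simp add: cube_term_def)
  then show ?thesis unfolding has_cube_term_def by blast
qed

section \<open>Running time of the elementary procedures\<close>

text \<open>Total correctness with a cost bound: excluding \<open>None\<close> rules out divergence
  and abortion.\<close>

definition runs_in :: "nat \<Rightarrow> ('b \<Rightarrow> bool) \<Rightarrow> 'b timed \<Rightarrow> bool" where
  "runs_in T P m \<longleftrightarrow> (\<exists>x t. m = Some (x, t) \<and> t \<le> T \<and> P x)"

lemma runs_in_weaken:
  assumes "runs_in T P m" "T \<le> T'" "\<And>x. P x \<Longrightarrow> P' x"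
  shows "runs_in T' P' m"
  using assms by (force simp: runs_in_def)

lemma runs_in_ret: "P x \<Longrightarrow> runs_in T P (ret x)"
  by (simp add: runs_in_def ret_def)

lemma runs_in_tick: "runs_in T P m \<Longrightarrow> runs_in (T + 1) P (tick m)"
  by (force simp: runs_in_def tick_def)

lemma runs_in_bind:
  assumes "runs_in T Q m" "\<And>x. Q x \<Longrightarrow> runs_in T' P (k x)"
  shows "runs_in (T + T') P (bind_timed m k)"
proof -
  obtain x t where m: "m = Some (x, t)" "t \<le> T" "Q x" using assms(1) by (auto simp: runs_in_def)
  then obtain y t' where "k x = Some (y, t')" "t' \<le> T'" "P y"
    using assms(2) by (fastforce simp: runs_in_def)
  then show ?thesis using m by (simp add: runs_in_def bind_timed_def)
qed

lemma runs_in_bind_ret: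
  assumes "runs_in T Q m" "\<And>x. Q x \<Longrightarrow> P (g x)"
  shows "runs_in T P (bind_timed m (\<lambda>x. ret (g x)))"
proof -
  have "runs_in (T + 0) P (bind_timed m (\<lambda>x. ret (g x)))"
    by (rule runs_in_bind[OF assms(1)]) (rule runs_in_ret, rule assms(2))
  then show ?thesis by simp
qed

lemma runs_in_and:
  assumes "runs_in T (\<lambda>b. b = P) m" "P \<Longrightarrow> runs_in T' (\<lambda>b. b = Q) m'"
  shows "runs_in (T + T') (\<lambda>b. b = (P \<and> Q)) (m \<and>\<^sub>T m')"
  unfolding and_timed_def
  by (rule runs_in_bind[OF assms(1)]) (use assms(2) in \<open>auto intro!: runs_in_ret\<close>)

lemma runs_in_imp:
  assumes "runs_in T (\<lambda>b. b = P) m" "P \<Longrightarrow> runs_in T' (\<lambda>b. b = Q) m'"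
  shows "runs_in (T + T') (\<lambda>b. b = (P \<longrightarrow> Q)) (m \<longrightarrow>\<^sub>T m')"
  unfolding imp_timed_def
  by (rule runs_in_bind[OF assms(1)]) (use assms(2) in \<open>auto intro!: runs_in_ret\<close>)

lemma runs_in_not:
  assumes "runs_in T (\<lambda>b. b = P) m"
  shows "runs_in T (\<lambda>b. b = (\<not> P)) (\<not>\<^sub>T m)"
  unfolding not_timed_def by (rule runs_in_bind_ret[OF assms]) simp

text \<open>The left side is the cost of a loop with \<open>l\<close> rounds: \<open>T\<close> for
  the body and one step per round, plus a final step. The bound is a multiple of
  \<open>N * T\<close> so that nested loops yield monomials in \<open>N\<close>.\<close>

lemma loop_bound:
  fixes l N T :: nat
  assumes "l \<le> N" "1 \<le> N" "1 \<le> T"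
  shows "l * (T + 1) + 1 \<le> 3 * N * T"
proof -
  have "l * (T + 1) \<le> N * (T + 1)" using assms(1) by (rule mult_right_mono) simp
  moreover have "N * (T + 1) = N * T + N" "3 * N * T = 3 * (N * T)" by simp_all
  moreover have "N \<le> N * T" using assms(3) by simp
  ultimately show ?thesis using assms(2) by linarith
qed

section \<open>Loops over lists and below a bound\<close>

lemma runs_in_allT:
  assumes "\<And>x. x \<in> set xs \<Longrightarrow> runs_in T (\<lambda>b. b = p x) (f x)"
    and N: "length xs \<le> N" "1 \<le> N" "1 \<le> T"
  shows "runs_in (3 * N * T) (\<lambda>b. b = (\<forall>x\<in>set xs. p x)) (allT f xs)"
proof -
  have "runs_in (length xs * (T + 1) + 1) (\<lambda>b. b = (\<forall>x\<in>set xs. p x)) (allT f xs)"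
    using assms(1)
  proof (induction xs)
    case Nil
    then show ?case using runs_in_tick[OF runs_in_ret, of _ True 0] by simp
  next
    case (Cons x xs)
    have "runs_in (T + (length xs * (T + 1) + 1)) (\<lambda>b. b = (\<forall>x\<in>set (x # xs). p x))
        (bind_timed (f x) (\<lambda>b. if b then allT f xs else ret False))"
      by (rule runs_in_bind[where Q = "\<lambda>b. b = p x"]) (use Cons in \<open>auto intro!: runs_in_ret\<close>)
    from runs_in_tick[OF this] show ?case by (simp add: algebra_simps)
  qed
  then show ?thesis by (rule runs_in_weaken[OF _ loop_bound[OF N]]) simp
qed

lemma runs_in_filterT:
  assumes "\<And>x. x \<in> set xs \<Longrightarrow> runs_in T (\<lambda>b. b = p x) (f x)"
    and N: "length xs \<le> N" "1 \<le> N" "1 \<le> T"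
  shows "runs_in (3 * N * T) (\<lambda>ys. ys = filter p xs) (filterT f xs)"
proof -
  have "runs_in (length xs * (T + 1) + 1) (\<lambda>ys. ys = filter p xs) (filterT f xs)"
    using assms(1)
  proof (induction xs)
    case Nil
    then show ?case using runs_in_tick[OF runs_in_ret, of "\<lambda>ys. ys = []" "[]" 0] by simp
  next
    case (Cons x xs)
    have "runs_in (T + (length xs * (T + 1) + 1)) (\<lambda>ys. ys = filter p (x # xs))
        (bind_timed (f x) (\<lambda>b. bind_timed (filterT f xs) (\<lambda>ys. ret (if b then x # ys else ys))))"
    proof (rule runs_in_bind)
      show "runs_in T (\<lambda>b. b = p x) (f x)" using Cons.prems by simp
      show "runs_in (length xs * (T + 1) + 1) (\<lambda>ys. ys = filter p (x # xs))
          (bind_timed (filterT f xs) (\<lambda>ys. ret (if b then x # ys else ys)))" if "b = p x" for b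
        by (rule runs_in_bind_ret[where Q = "\<lambda>ys. ys = filter p xs"]) (use Cons that in auto)
    qed
    from runs_in_tick[OF this] show ?case by (simp add: algebra_simps)
  qed
  then show ?thesis by (rule runs_in_weaken[OF _ loop_bound[OF N]]) simp
qed

lemma runs_in_mapT:
  assumes "\<And>x. x \<in> set xs \<Longrightarrow> runs_in T (P x) (f x)"
    and N: "length xs \<le> N" "1 \<le> N" "1 \<le> T"
  shows "runs_in (3 * N * T) (list_all2 P xs) (mapT f xs)"
proof -
  have "runs_in (length xs * (T + 1) + 1) (list_all2 P xs) (mapT f xs)"
    using assms(1)
  proof (induction xs)
    case Nil
    then show ?case using runs_in_tick[OF runs_in_ret, of "\<lambda>ys. ys = []" "[]" 0] by simp
  next
    case (Cons x xs)
    have "runs_in (T + (length xs * (T + 1) + 1)) (list_all2 P (x # xs))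
        (bind_timed (f x) (\<lambda>y. bind_timed (mapT f xs) (\<lambda>ys. ret (y # ys))))"
    proof (rule runs_in_bind)
      show "runs_in T (P x) (f x)" using Cons.prems by simp
      show "runs_in (length xs * (T + 1) + 1) (list_all2 P (x # xs))
          (bind_timed (mapT f xs) (\<lambda>ys. ret (y # ys)))" if "P x y" for y
        by (rule runs_in_bind_ret[where Q = "list_all2 P xs"]) (use Cons that in auto)
    qed
    from runs_in_tick[OF this] show ?case by (simp add: algebra_simps)
  qed
  then show ?thesis by (rule runs_in_weaken[OF _ loop_bound[OF N]])
qed

text \<open>The invariant refers to the set of items already processed; for the induction its start
  is generalised from \<open>{}\<close> to any \<open>M\<close>.\<close>

lemma runs_in_foldT:
  assumes step: "\<And>x s M. x \<in> set xs \<Longrightarrow> I M s \<Longrightarrow> runs_in T (I (insert x M)) (f x s)"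
    and init: "I {} s"
    and N: "length xs \<le> N" "1 \<le> N" "1 \<le> T"
  shows "runs_in (3 * N * T) (I (set xs)) (foldT f xs s)"
proof -
  have "runs_in (length xs * (T + 1) + 1) (I (M \<union> set xs)) (foldT f xs s)" if "I M s" for M
    using step that
  proof (induction xs arbitrary: s M)
    case Nil
    then show ?case using runs_in_tick[OF runs_in_ret, of "I M" s 0] by simp
  next
    case (Cons x xs)
    have "runs_in (T + (length xs * (T + 1) + 1)) (I (insert x M \<union> set xs)) (bind_timed (f x s) (foldT f xs))"
    proof (rule runs_in_bind)
      show "runs_in T (I (insert x M)) (f x s)" using Cons.prems by simp
      show "runs_in (length xs * (T + 1) + 1) (I (insert x M \<union> set xs)) (foldT f xs s')"
        if "I (insert x M) s'" for s'
        by (rule Cons.IH) (use Cons.prems(1) that in auto)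
    qed
    from runs_in_tick[OF this] show ?case by (simp add: algebra_simps)
  qed
  from this[OF init] show ?thesis by (intro runs_in_weaken[OF _ loop_bound[OF N]]) simp_all
qed

lemma runs_in_ex_belowT:
  assumes "\<And>j. j < q \<Longrightarrow> runs_in T (\<lambda>b. b = p j) (f j)"
    and N: "q \<le> N" "1 \<le> N" "1 \<le> T"
  shows "runs_in (3 * N * T) (\<lambda>b. b = (\<exists>j<q. p j)) (ex_belowT f q)"
proof -
  have "runs_in (q * (T + 1) + 1) (\<lambda>b. b = (\<exists>j<q. p j)) (ex_belowT f q)"
    using assms(1)
  proof (induction q)
    case 0
    then show ?case using runs_in_tick[OF runs_in_ret, of _ False 0] by simp
  next
    case (Suc q)
    have "runs_in (T + (q * (T + 1) + 1)) (\<lambda>b. b = (\<exists>j<Suc q. p j))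
        (bind_timed (f q) (\<lambda>b. if b then ret True else ex_belowT f q))"
    proof (rule runs_in_bind)
      show "runs_in T (\<lambda>b. b = p q) (f q)" using Suc.prems by simp
      fix b assume b: "b = p q"
      have "runs_in (q * (T + 1) + 1) (\<lambda>b. b = (\<exists>j<q. p j)) (ex_belowT f q)"
        using Suc.prems by (intro Suc.IH) simp
      then show "runs_in (q * (T + 1) + 1) (\<lambda>b. b = (\<exists>j<Suc q. p j))
          (if b then ret True else ex_belowT f q)"
        using b by (auto simp: less_Suc_eq intro: runs_in_ret elim!: runs_in_weaken)
    qed
    from runs_in_tick[OF this] show ?case by (simp add: algebra_simps)
  qed
  then show ?thesis by (rule runs_in_weaken[OF _ loop_bound[OF N]]) simp
qed

section \<open>Lookup, and sets represented by lists\<close>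

lemma runs_in_nthT:
  assumes "i < length xs" "length xs \<le> N"
  shows "runs_in N (\<lambda>x. x = xs ! i) (nthT xs i)"
proof -
  have "runs_in (i + 1) (\<lambda>x. x = xs ! i) (nthT xs i)"
    using assms(1)
  proof (induction xs arbitrary: i)
    case (Cons x xs)
    show ?case
    proof (cases i)
      case 0
      then show ?thesis using runs_in_tick[OF runs_in_ret, of _ x 0] by simp
    next
      case (Suc i')
      then show ?thesis using runs_in_tick[OF Cons.IH[of i']] Cons.prems by simp
    qed
  qed simp
  then show ?thesis by (rule runs_in_weaken) (use assms in auto)
qed

lemma runs_in_memT:
  assumes "length ys \<le> N" "1 \<le> N"
  shows "runs_in (2 * N) (\<lambda>b. b = (x \<in> set ys)) (memT x ys)"
proof -
  have "runs_in (length ys + 1) (\<lambda>b. b = (x \<in> set ys)) (memT x ys)"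
  proof (induction ys)
    case Nil
    then show ?case using runs_in_tick[OF runs_in_ret, of _ False 0] by simp
  next
    case (Cons y ys)
    have "runs_in (length ys + 1) (\<lambda>b. b = (x \<in> set (y # ys))) (if x = y then ret True else memT x ys)"
      using Cons by (auto intro: runs_in_ret)
    from runs_in_tick[OF this] show ?case by simp
  qed
  then show ?thesis by (rule runs_in_weaken) (use assms in auto)
qed

lemma runs_in_subsetT:
  assumes "length xs \<le> N" "length ys \<le> N" "1 \<le> N"
  shows "runs_in (6 * N ^ 2) (\<lambda>b. b = (set xs \<subseteq> set ys)) (subsetT xs ys)"
  unfolding subsetT_def
  by (rule runs_in_weaken[OF runs_in_allT[OF runs_in_memT[OF assms(2,3)] assms(1,3)]])
    (use assms(3) in \<open>auto simp: power2_eq_square\<close>)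

lemma runs_in_insertT:
  assumes "distinct xs" "length xs \<le> N" "1 \<le> N"
  shows "runs_in (2 * N) (\<lambda>r. distinct r \<and> set r = insert x (set xs)) (insertT x xs)"
  unfolding insertT_def
  by (rule runs_in_bind_ret[OF runs_in_memT[OF assms(2,3)]]) (use assms(1) in auto)

lemma runs_in_interT:
  assumes "length xs \<le> N" "length ys \<le> N" "1 \<le> N"
  shows "runs_in (6 * N ^ 2) (\<lambda>r. r = filter (\<lambda>x. x \<in> set ys) xs) (interT xs ys)"
  unfolding interT_def
  by (rule runs_in_weaken[OF runs_in_filterT[OF runs_in_memT[OF assms(2,3)] assms(1,3)]])
    (use assms(3) in \<open>auto simp: power2_eq_square\<close>)

section \<open>Analysis of the algorithm\<close>

text \<open>These equations collapse the costs of nested loops into monomials, which can then be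
  compared by linear arithmetic with powers as atoms.\<close>

lemma mult_nat_powers:
  fixes n :: nat
  shows "a * n * (c * n) = a * c * n ^ 2" "a * n * (c * n ^ 2) = a * c * n ^ 3"
    "a * n * (c * n ^ 3) = a * c * n ^ 4" "a * n * (c * n ^ 4) = a * c * n ^ 5"
    "a * n * (c * n ^ 5) = a * c * n ^ 6" "a * n * (c * n ^ 6) = a * c * n ^ 7"
    "n * (c * n ^ 7) = c * n ^ 8"
  by (simp_all add: eval_nat_numeral algebra_simps)

text \<open>One number \<open>N\<close> bounds the elements, the tables, the arities and the rows.
  It becomes the input size once there are at least two elements.\<close>

locale presented_algebra =
  fixes \<A> :: "'a alg" and elems :: "'a list" and tabs :: "'a table list" and N :: nat
  assumes alg: "algebra \<A>" and fin: "finite (carrier \<A>)"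
    and pres: "presents elems tabs \<A>"
    and N: "1 \<le> N" and card_le: "card (carrier \<A>) \<le> N" and tabs_le: "length tabs \<le> N"
    and table_le: "(q, rows) \<in> set tabs \<Longrightarrow> q \<le> N \<and> length rows \<le> N"
begin

lemma N_powers: "1 \<le> N" "N \<le> N ^ 2" "N ^ 2 \<le> N ^ 3" "N ^ 3 \<le> N ^ 4" "N ^ 4 \<le> N ^ 5" "N ^ 5 \<le> N ^ 6"
    "N ^ 6 \<le> N ^ 7" "N ^ 7 \<le> N ^ 8"
  using N by (auto simp: self_le_power power_increasing)

lemma elems: "distinct elems" "set elems = carrier \<A>" "length elems \<le> N"
  using pres card_le by (auto simp: presents_def dest: distinct_card)

lemma length_le: "distinct xs \<Longrightarrow> set xs \<subseteq> carrier \<A> \<Longrightarrow> length xs \<le> N"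
  using card_mono[OF fin, of "set xs"] card_le by (simp add: distinct_card)

lemma op_table:
  assumes "(q, f) \<in> set (ops \<A>)"
  shows "\<exists>rows. (q, rows) \<in> set tabs \<and> set rows = {(as, f as) | as. length as = q \<and> set as \<subseteq> carrier \<A>}"
proof -
  have *: "list_all2 (table_of (carrier \<A>)) (ops \<A>) tabs" using pres by (simp add: presents_def)
  obtain i where i: "i < length (ops \<A>)" "ops \<A> ! i = (q, f)" using assms by (metis in_set_conv_nth)
  have "table_of (carrier \<A>) (q, f) (tabs ! i)" "i < length tabs"
    using list_all2_nthD[OF * i(1)] list_all2_lengthD[OF *] i by auto
  then show ?thesis using nth_mem[of i tabs] by (cases "tabs ! i") (auto simp: table_of_def)
qed

lemma table_op:
  assumes "(q, rows) \<in> set tabs"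
  shows "\<exists>f. (q, f) \<in> set (ops \<A>) \<and> set rows = {(as, f as) | as. length as = q \<and> set as \<subseteq> carrier \<A>}"
proof -
  have *: "list_all2 (table_of (carrier \<A>)) (ops \<A>) tabs" using pres by (simp add: presents_def)
  obtain i where i: "i < length tabs" "tabs ! i = (q, rows)" using assms by (metis in_set_conv_nth)
  have "table_of (carrier \<A>) (ops \<A> ! i) (q, rows)" "i < length (ops \<A>)"
    using list_all2_nthD2[OF * i(1)] list_all2_lengthD[OF *] i by auto
  then show ?thesis using nth_mem[of i "ops \<A>"] by (cases "ops \<A> ! i") (auto simp: table_of_def)
qed

lemma row:
  assumes "(q, rows) \<in> set tabs" "(as, v) \<in> set rows"
  shows "length as = q" "set as \<subseteq> carrier \<A>" "v \<in> carrier \<A>" "length as \<le> N"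
proof -
  obtain f where "(q, f) \<in> set (ops \<A>)"
    "set rows = {(as, f as) | as. length as = q \<and> set as \<subseteq> carrier \<A>}"
    using table_op[OF assms(1)] by blast
  then show "length as = q" "set as \<subseteq> carrier \<A>" "v \<in> carrier \<A>"
    using assms(2) subuniverseD[OF subuniverse_carrier[OF alg]] by auto
  then show "length as \<le> N" using table_le[OF assms(1)] by simp
qed

section \<open>Closure and absorption read off the tables\<close>

lemma subuniverse_iff_tabs:
  assumes "B \<subseteq> carrier \<A>"
  shows "subuniverse \<A> B \<longleftrightarrow>
    (\<forall>(q, rows) \<in> set tabs. \<forall>(as, v) \<in> set rows. set as \<subseteq> B \<longrightarrow> v \<in> B)"
proof
  assume B: "subuniverse \<A> B"
  have "v \<in> B" if t: "(q, rows) \<in> set tabs" "(as, v) \<in> set rows" "set as \<subseteq> B" for q rows as v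
    using table_op[OF t(1)] t(2,3) subuniverseD[OF B] by auto
  then show "\<forall>(q, rows) \<in> set tabs. \<forall>(as, v) \<in> set rows. set as \<subseteq> B \<longrightarrow> v \<in> B" by blast
next
  assume *: "\<forall>(q, rows) \<in> set tabs. \<forall>(as, v) \<in> set rows. set as \<subseteq> B \<longrightarrow> v \<in> B"
  show "subuniverse \<A> B"
  proof (rule subuniverseI[OF assms])
    fix q f as assume f: "(q, f) \<in> set (ops \<A>)" "length as = q" "set as \<subseteq> B"
    obtain rows where r: "(q, rows) \<in> set tabs"
      "set rows = {(as, f as) | as. length as = q \<and> set as \<subseteq> carrier \<A>}"
      using op_table[OF f(1)] by blast
    then have "(as, f as) \<in> set rows" using f assms by blast
    then show "f as \<in> B" using * r(1) f(3) by blast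
  qed
qed

lemma op_blocker_iff_tabs:
  assumes CD: "C \<noteq> {}" "C \<subset> D" "subuniverse \<A> D"
  shows "op_blocker \<A> C D \<longleftrightarrow>
    (\<forall>(q, rows) \<in> set tabs. \<exists>j<q. \<forall>(as, v) \<in> set rows. set as \<subseteq> D \<and> as ! j \<in> C \<longrightarrow> v \<in> C)"
    (is "_ \<longleftrightarrow> ?R")
proof
  assume blk: "op_blocker \<A> C D"
  have "\<exists>j<q. \<forall>(as, v) \<in> set rows. set as \<subseteq> D \<and> as ! j \<in> C \<longrightarrow> v \<in> C"
    if t: "(q, rows) \<in> set tabs" for q rows
  proof -
    obtain f where f: "(q, f) \<in> set (ops \<A>)"
      "set rows = {(as, f as) | as. length as = q \<and> set as \<subseteq> carrier \<A>}"
      using table_op[OF t] by blast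
    obtain j where "j < q" "\<And>as. length as = q \<Longrightarrow> set as \<subseteq> D \<Longrightarrow> as ! j \<in> C \<Longrightarrow> f as \<in> C"
      using op_blockerE[OF blk f(1)] by metis
    then show ?thesis using f(2) by (intro exI[of _ j]) auto
  qed
  then show ?R by blast
next
  assume R: ?R
  show "op_blocker \<A> C D"
  proof (rule op_blockerI[OF CD])
    fix q f assume f: "(q, f) \<in> set (ops \<A>)"
    obtain rows where r: "(q, rows) \<in> set tabs"
      "set rows = {(as, f as) | as. length as = q \<and> set as \<subseteq> carrier \<A>}"
      using op_table[OF f] by blast
    obtain j where j: "j < q" "\<forall>(as, v) \<in> set rows. set as \<subseteq> D \<and> as ! j \<in> C \<longrightarrow> v \<in> C"
      using R r(1) by blast
    have "(as, f as) \<in> set rows" if "length as = q" "set as \<subseteq> D" for as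
      using that r(2) subuniverse_subset[OF CD(3)] by blast
    then show "\<exists>j<q. \<forall>as. length as = q \<and> set as \<subseteq> D \<and> as ! j \<in> C \<longrightarrow> f as \<in> C"
      using j by blast
  qed
qed

text \<open>Rows are tested against the growing list, so a pass may already use elements that it has
  added. What is recorded is that the list stays inside the generated subuniverse and covers all
  rows over the initial \<open>B\<close>; if it does not grow, \<open>B\<close> is closed.\<close>

lemma runs_in_close_onceT:
  assumes B: "distinct B" "set B \<subseteq> carrier \<A>"
  shows "runs_in (72 * N ^ 4) (\<lambda>B'. distinct B' \<and> set B \<subseteq> set B' \<and> set B' \<subseteq> Sg \<A> (set B) \<and>
      (\<forall>(q, rows) \<in> set tabs. \<forall>(as, v) \<in> set rows. set as \<subseteq> set B \<longrightarrow> v \<in> set B'))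
    (close_onceT tabs B)"
proof -
  define J where "J B' \<longleftrightarrow> distinct B' \<and> set B \<subseteq> set B' \<and> set B' \<subseteq> Sg \<A> (set B)" for B'
  have Sg: "subuniverse \<A> (Sg \<A> (set B))" using alg B by (intro subuniverse_Sg)
  \<comment> \<open>\<open>P\<close> persists when the list grows, so the rows treated earlier stay
    covered.\<close>
  define P where "P M B' \<longleftrightarrow> (\<forall>(as, v) \<in> M. set as \<subseteq> set B \<longrightarrow> v \<in> set B')"
    for M :: "('a list \<times> 'a) set" and B' :: "'a list"
  define step :: "'a list \<times> 'a \<Rightarrow> 'a list \<Rightarrow> 'a list timed"
    where "step = (\<lambda>(as, v) B. bind_timed (subsetT as B) (\<lambda>b. if b then insertT v B else ret B))"
  have row_step: "runs_in (8 * N ^ 2) (\<lambda>B''. J B'' \<and> set B' \<subseteq> set B'' \<and> P {(as, v)} B'') (step (as, v) B')"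
    if t: "(q, rows) \<in> set tabs" "(as, v) \<in> set rows" and J: "J B'" for q rows as v B'
  proof -
    have l: "length B' \<le> N"
      using J subuniverse_subset[OF Sg] by (intro length_le) (auto simp: J_def)
    have "runs_in (6 * N ^ 2 + 2 * N) (\<lambda>B''. J B'' \<and> set B' \<subseteq> set B'' \<and> P {(as, v)} B'') (step (as, v) B')"
      unfolding step_def prod.case
    proof (rule runs_in_bind[OF runs_in_subsetT[OF row(4)[OF t] l N]])
      fix b assume b: "b = (set as \<subseteq> set B')"
      show "runs_in (2 * N) (\<lambda>B''. J B'' \<and> set B' \<subseteq> set B'' \<and> P {(as, v)} B'')
          (if b then insertT v B' else ret B')"
      proof (cases b)
        case True
        then have "set as \<subseteq> Sg \<A> (set B)" using b J by (auto simp: J_def)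
        then have "v \<in> Sg \<A> (set B)"
          using Sg subuniverse_iff_tabs[OF subuniverse_subset[OF Sg]] t by blast
        then have "runs_in (2 * N) (\<lambda>B''. J B'' \<and> set B' \<subseteq> set B'' \<and> P {(as, v)} B'') (insertT v B')"
          using J by (intro runs_in_weaken[OF runs_in_insertT[OF _ l N]]) (auto simp: J_def P_def)
        then show ?thesis using True by simp
      next
        case False
        then show ?thesis using b J by (auto simp: J_def P_def intro!: runs_in_ret)
      qed
    qed
    then show ?thesis by (rule runs_in_weaken) (use N_powers in linarith)+
  qed
  have table_step: "runs_in (24 * N ^ 3) (\<lambda>B''. J B'' \<and> set B' \<subseteq> set B'' \<and> P (set rows) B'') (foldT step rows B')"
    if t: "(q, rows) \<in> set tabs" and J: "J B'" for q rows B'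
  proof -
    have "runs_in (3 * N * (8 * N ^ 2)) (\<lambda>B''. J B'' \<and> set B' \<subseteq> set B'' \<and> P (set rows) B'') (foldT step rows B')"
    proof (rule runs_in_foldT[where I = "\<lambda>M B''. J B'' \<and> set B' \<subseteq> set B'' \<and> P M B''"])
      fix x s M assume x: "x \<in> set rows" and s: "J s \<and> set B' \<subseteq> set s \<and> P M s"
      obtain as v where xe: "x = (as, v)" by (cases x)
      show "runs_in (8 * N ^ 2) (\<lambda>B''. J B'' \<and> set B' \<subseteq> set B'' \<and> P (insert x M) B'') (step x s)"
      proof (rule runs_in_weaken[OF row_step[OF t, of as v s, folded xe] order_refl])
        fix B'' assume "J B'' \<and> set s \<subseteq> set B'' \<and> P {x} B''"
        then show "J B'' \<and> set B' \<subseteq> set B'' \<and> P (insert x M) B''"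
          using s unfolding P_def by blast
      qed (use x xe s in auto)
    qed (use J N table_le[OF t] in \<open>auto simp: P_def\<close>)
    then show ?thesis unfolding mult_nat_powers by simp
  qed
  have "close_onceT tabs B = foldT (\<lambda>(q, rows). foldT step rows) tabs B"
    by (simp add: close_onceT_def step_def)
  moreover have "runs_in (3 * N * (24 * N ^ 3)) (\<lambda>B'. J B' \<and> (\<forall>(q, rows) \<in> set tabs. P (set rows) B'))
      (foldT (\<lambda>(q, rows). foldT step rows) tabs B)"
  proof (rule runs_in_foldT[where I = "\<lambda>M B'. J B' \<and> (\<forall>(q, rows) \<in> M. P (set rows) B')"])
    fix x s and M :: "'a table set"
    assume x: "x \<in> set tabs" and s: "J s \<and> (\<forall>(q, rows) \<in> M. P (set rows) s)"
    obtain q rows where xe: "x = (q, rows)" by (cases x)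
    show "runs_in (24 * N ^ 3) (\<lambda>B'. J B' \<and> (\<forall>(q, rows) \<in> insert x M. P (set rows) B'))
        ((case x of (q, rows) \<Rightarrow> foldT step rows) s)"
      unfolding xe prod.case
    proof (rule runs_in_weaken[OF table_step[of q rows s] order_refl])
      fix B' assume "J B' \<and> set s \<subseteq> set B' \<and> P (set rows) B'"
      moreover from this have "P (set r) B'" if "P (set r) s" for r
        using that unfolding P_def by blast
      ultimately show "J B' \<and> (\<forall>(q, rows) \<in> insert (q, rows) M. P (set rows) B')"
        using s by blast
    qed (use x xe s in auto)
  qed (use N tabs_le B Sg_superset[of "set B" \<A>] in \<open>auto simp: J_def\<close>)
  ultimately show ?thesis
    unfolding mult_nat_powers J_def P_def by (simp add: runs_in_def)
qed

text \<open>Every pass that does not stop adds an element, so the number of missing elements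
  decreases. The factor 79 = 72 + 6 + 1 counts the pass, the comparison and the step of the
  call.\<close>

lemma runs_in_closureT:
  assumes "distinct B" "set B \<subseteq> carrier \<A>"
  shows "runs_in (158 * N ^ 5) (\<lambda>R. distinct R \<and> set R = Sg \<A> (set B)) (closureT tabs B)"
proof -
  have "runs_in ((card (carrier \<A>) - card (set B) + 1) * (79 * N ^ 4))
      (\<lambda>R. distinct R \<and> set R = Sg \<A> (set B)) (closureT tabs B)"
    using assms
  proof (induction "card (carrier \<A>) - card (set B)" arbitrary: B rule: less_induct)
    case less
    let ?m = "card (carrier \<A>) - card (set B)"
    let ?Q = "\<lambda>R. distinct R \<and> set R = Sg \<A> (set B)"
    have Sg: "subuniverse \<A> (Sg \<A> (set B))" using alg less.prems by (intro subuniverse_Sg)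
    have "runs_in (72 * N ^ 4 + (6 * N ^ 2 + ?m * (79 * N ^ 4))) ?Q
      (bind_timed (close_onceT tabs B) (\<lambda>B'. bind_timed (subsetT B' B)
        (\<lambda>stable. if stable then ret B else closureT tabs B')))"
    proof (rule runs_in_bind[OF runs_in_close_onceT[OF less.prems]], rule runs_in_bind)
      fix B' assume B': "distinct B' \<and> set B \<subseteq> set B' \<and> set B' \<subseteq> Sg \<A> (set B) \<and>
        (\<forall>(q, rows) \<in> set tabs. \<forall>(as, v) \<in> set rows. set as \<subseteq> set B \<longrightarrow> v \<in> set B')"
      then have B'A: "set B' \<subseteq> carrier \<A>" using subuniverse_subset[OF Sg] by blast
      show "runs_in (6 * N ^ 2) (\<lambda>b. b = (set B' \<subseteq> set B)) (subsetT B' B)"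
        using B' B'A less.prems by (intro runs_in_subsetT length_le N) auto
      fix stable assume st: "stable = (set B' \<subseteq> set B)"
      show "runs_in (?m * (79 * N ^ 4)) ?Q (if stable then ret B else closureT tabs B')"
      proof (cases stable)
        case True
        then have "set B' = set B" using st B' by blast
        then have "subuniverse \<A> (set B)" using subuniverse_iff_tabs[OF less.prems(2)] B' by simp
        then have "Sg \<A> (set B) = set B" using Sg_superset[of "set B" \<A>] Sg_least[of \<A> "set B" "set B"] by blast
        then show ?thesis using True less.prems by (auto intro!: runs_in_ret)
      next
        case False
        then have "set B \<subset> set B'" using st B' by blast
        then have "card (set B) < card (set B')" by (simp add: psubset_card_mono)
        moreover have "card (set B') \<le> card (carrier \<A>)" using card_mono[OF fin B'A] .
        ultimately have less_card: "card (carrier \<A>) - card (set B') + 1 \<le> ?m" by simp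
        \<comment> \<open>\<open>B'\<close> lies between \<open>B\<close> and the subuniverse
          generated by \<open>B\<close>.\<close>
        have "Sg \<A> (set B') = Sg \<A> (set B)"
        proof
          show "Sg \<A> (set B') \<subseteq> Sg \<A> (set B)" using Sg B' by (intro Sg_least) auto
          have "set B \<subseteq> Sg \<A> (set B')" using B' Sg_superset[of "set B'" \<A>] by blast
          then show "Sg \<A> (set B) \<subseteq> Sg \<A> (set B')" by (intro Sg_least subuniverse_Sg alg B'A)
        qed
        then have "runs_in ((card (carrier \<A>) - card (set B') + 1) * (79 * N ^ 4)) ?Q (closureT tabs B')"
          using less.hyps[of B'] less_card B' B'A by simp
        then have "runs_in (?m * (79 * N ^ 4)) ?Q (closureT tabs B')"
          by (rule runs_in_weaken) (use mult_right_mono[OF less_card] in auto)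
        then show ?thesis using False by simp
      qed
    qed
    from runs_in_tick[OF this] have "runs_in (72 * N ^ 4 + (6 * N ^ 2 + ?m * (79 * N ^ 4)) + 1) ?Q (closureT tabs B)"
      by (subst closureT.simps)
    then show ?case
    proof (rule runs_in_weaken)
      show "72 * N ^ 4 + (6 * N ^ 2 + ?m * (79 * N ^ 4)) + 1 \<le> (?m + 1) * (79 * N ^ 4)"
        unfolding distrib_right mult_1 using N_powers by linarith
    qed
  qed
  then show ?thesis
  proof (rule runs_in_weaken)
    have "card (carrier \<A>) - card (set B) + 1 \<le> 2 * N" using card_le N by linarith
    then have "(card (carrier \<A>) - card (set B) + 1) * (79 * N ^ 4) \<le> 2 * N * (79 * N ^ 4)"
      by (rule mult_right_mono) simp
    then show "(card (carrier \<A>) - card (set B) + 1) * (79 * N ^ 4) \<le> 158 * N ^ 5"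
      unfolding mult_nat_powers by simp
  qed
qed

lemma runs_in_SgT:
  assumes "c \<in> carrier \<A>" "d \<in> carrier \<A>"
  shows "runs_in (160 * N ^ 5) (\<lambda>R. distinct R \<and> set R = Sg \<A> {c, d}) (SgT tabs c d)"
proof -
  have "runs_in (2 * N + 158 * N ^ 5) (\<lambda>R. distinct R \<and> set R = Sg \<A> {c, d}) (SgT tabs c d)"
    unfolding SgT_def
  proof (rule runs_in_bind[OF runs_in_insertT])
    fix X assume X: "distinct X \<and> set X = insert c (set [d])"
    then have "set X = {c, d}" by simp
    then show "runs_in (158 * N ^ 5) (\<lambda>R. distinct R \<and> set R = Sg \<A> {c, d}) (closureT tabs X)"
      using runs_in_closureT[of X] X assms by simp
  qed (use N in auto)
  then show ?thesis by (rule runs_in_weaken) (use N_powers in linarith)+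
qed

section \<open>The blocker test\<close>

lemma runs_in_subuniverseT:
  assumes B: "distinct B" "set B \<subseteq> carrier \<A>"
  shows "runs_in (78 * N ^ 4) (\<lambda>b. b = subuniverse \<A> (set B)) (subuniverseT elems tabs B)"
proof -
  have l: "length B \<le> N" using length_le B .
  have rows: "runs_in (24 * N ^ 3) (\<lambda>b. b = (\<forall>x \<in> set rows. case x of (as, v) \<Rightarrow> set as \<subseteq> set B \<longrightarrow> v \<in> set B))
      (allT (\<lambda>(as, v). subsetT as B \<longrightarrow>\<^sub>T memT v B) rows)" if t: "(q, rows) \<in> set tabs" for q rows
  proof -
    have "runs_in (3 * N * (8 * N ^ 2))
        (\<lambda>b. b = (\<forall>x \<in> set rows. case x of (as, v) \<Rightarrow> set as \<subseteq> set B \<longrightarrow> v \<in> set B))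
        (allT (\<lambda>(as, v). subsetT as B \<longrightarrow>\<^sub>T memT v B) rows)"
    proof (rule runs_in_allT)
      fix x assume x: "x \<in> set rows"
      obtain as v where [simp]: "x = (as, v)" by (cases x)
      have "runs_in (6 * N ^ 2 + 2 * N) (\<lambda>b. b = (set as \<subseteq> set B \<longrightarrow> v \<in> set B)) (subsetT as B \<longrightarrow>\<^sub>T memT v B)"
        using row(4)[OF t] x l N by (intro runs_in_imp runs_in_subsetT runs_in_memT) auto
      then show "runs_in (8 * N ^ 2) (\<lambda>b. b = (case x of (as, v) \<Rightarrow> set as \<subseteq> set B \<longrightarrow> v \<in> set B))
          (case x of (as, v) \<Rightarrow> subsetT as B \<longrightarrow>\<^sub>T memT v B)"
        by (auto elim!: runs_in_weaken) (use N_powers in linarith)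
    qed (use N table_le[OF t] in auto)
    then show ?thesis unfolding mult_nat_powers by simp
  qed
  have "runs_in (3 * N * (24 * N ^ 3))
      (\<lambda>b. b = (\<forall>x \<in> set tabs. case x of (q, rows) \<Rightarrow>
        \<forall>x \<in> set rows. case x of (as, v) \<Rightarrow> set as \<subseteq> set B \<longrightarrow> v \<in> set B))
      (allT (\<lambda>(q, rows). allT (\<lambda>(as, v). subsetT as B \<longrightarrow>\<^sub>T memT v B) rows) tabs)"
    by (rule runs_in_allT) (use N tabs_le rows in auto)
  from runs_in_and[OF runs_in_subsetT[OF l elems(3) N] this]
  show ?thesis
    unfolding subuniverseT_def
  proof (rule runs_in_weaken)
    show "6 * N ^ 2 + 3 * N * (24 * N ^ 3) \<le> 78 * N ^ 4"
      unfolding mult_nat_powers using N_powers by linarith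
  qed (use subuniverse_iff_tabs[OF B(2)] B(2) elems(2) in simp)
qed

text \<open>Three nested loops run over a body of cost at most \<open>11 * N ^ 2\<close>: an
  inclusion, the lookup of argument \<open>j\<close> and two membership tests. Each loop contributes
  a factor \<open>3 * N\<close>.\<close>

lemma runs_in_absorption_test:
  assumes C: "distinct C" "set C \<subseteq> carrier \<A>" and D: "distinct D" "set D \<subseteq> carrier \<A>"
  shows "runs_in (297 * N ^ 5) (\<lambda>b. b = (\<forall>(q, rows) \<in> set tabs. \<exists>j<q. \<forall>(as, v) \<in> set rows.
        set as \<subseteq> set D \<and> as ! j \<in> set C \<longrightarrow> v \<in> set C))
    (allT (\<lambda>(q, rows). ex_belowT (\<lambda>j. allT (\<lambda>(as, v).
        (subsetT as D \<and>\<^sub>T bind_timed (nthT as j) (\<lambda>x. memT x C)) \<longrightarrow>\<^sub>T memT v C) rows) q) tabs)"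
proof -
  note l = length_le[OF C] length_le[OF D]
  have rows: "runs_in (33 * N ^ 3)
      (\<lambda>b. b = (\<forall>x \<in> set rows. case x of (as, v) \<Rightarrow> set as \<subseteq> set D \<and> as ! j \<in> set C \<longrightarrow> v \<in> set C))
      (allT (\<lambda>(as, v). (subsetT as D \<and>\<^sub>T bind_timed (nthT as j) (\<lambda>x. memT x C)) \<longrightarrow>\<^sub>T memT v C) rows)"
    if t: "(q, rows) \<in> set tabs" and j: "j < q" for q rows j
  proof -
    have "runs_in (3 * N * (11 * N ^ 2))
        (\<lambda>b. b = (\<forall>x \<in> set rows. case x of (as, v) \<Rightarrow> set as \<subseteq> set D \<and> as ! j \<in> set C \<longrightarrow> v \<in> set C))
        (allT (\<lambda>(as, v). (subsetT as D \<and>\<^sub>T bind_timed (nthT as j) (\<lambda>x. memT x C)) \<longrightarrow>\<^sub>T memT v C) rows)"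
    proof (rule runs_in_allT)
      fix x assume x: "x \<in> set rows"
      obtain as v where [simp]: "x = (as, v)" by (cases x)
      have as: "length as = q" "length as \<le> N" using row[OF t, of as v] x by auto
      have "runs_in (N + 2 * N) (\<lambda>b. b = (as ! j \<in> set C)) (bind_timed (nthT as j) (\<lambda>x. memT x C))"
        by (rule runs_in_bind[OF runs_in_nthT]) (use as j runs_in_memT[OF l(1) N] in auto)
      then have "runs_in (6 * N ^ 2 + (N + 2 * N) + 2 * N)
          (\<lambda>b. b = (set as \<subseteq> set D \<and> as ! j \<in> set C \<longrightarrow> v \<in> set C))
          ((subsetT as D \<and>\<^sub>T bind_timed (nthT as j) (\<lambda>x. memT x C)) \<longrightarrow>\<^sub>T memT v C)"
        using as l N by (intro runs_in_imp runs_in_and runs_in_subsetT runs_in_memT) auto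
      then have "runs_in (11 * N ^ 2)
          (\<lambda>b. b = (set as \<subseteq> set D \<and> as ! j \<in> set C \<longrightarrow> v \<in> set C))
          ((subsetT as D \<and>\<^sub>T bind_timed (nthT as j) (\<lambda>x. memT x C)) \<longrightarrow>\<^sub>T memT v C)"
        by (rule runs_in_weaken) (use N_powers in linarith)+
      then show "runs_in (11 * N ^ 2)
          (\<lambda>b. b = (case x of (as, v) \<Rightarrow> set as \<subseteq> set D \<and> as ! j \<in> set C \<longrightarrow> v \<in> set C))
          (case x of (as, v) \<Rightarrow>
            (subsetT as D \<and>\<^sub>T bind_timed (nthT as j) (\<lambda>x. memT x C)) \<longrightarrow>\<^sub>T memT v C)"
        by simp
    qed (use N table_le[OF t] in auto)
    then show ?thesis unfolding mult_nat_powers by simp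
  qed
  have tab: "runs_in (99 * N ^ 4)
      (\<lambda>b. b = (\<exists>j<q. \<forall>x \<in> set rows. case x of (as, v) \<Rightarrow> set as \<subseteq> set D \<and> as ! j \<in> set C \<longrightarrow> v \<in> set C))
      (ex_belowT (\<lambda>j. allT (\<lambda>(as, v).
        (subsetT as D \<and>\<^sub>T bind_timed (nthT as j) (\<lambda>x. memT x C)) \<longrightarrow>\<^sub>T memT v C) rows) q)"
    if t: "(q, rows) \<in> set tabs" for q rows
  proof (rule runs_in_weaken[OF runs_in_ex_belowT[OF rows[OF t]]])
    show "3 * N * (33 * N ^ 3) \<le> 99 * N ^ 4" unfolding mult_nat_powers by simp
  qed (use N table_le[OF t] in auto)
  have "runs_in (3 * N * (99 * N ^ 4)) (\<lambda>b. b = (\<forall>x \<in> set tabs. case x of (q, rows) \<Rightarrow>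
        \<exists>j<q. \<forall>x \<in> set rows. case x of (as, v) \<Rightarrow> set as \<subseteq> set D \<and> as ! j \<in> set C \<longrightarrow> v \<in> set C))
    (allT (\<lambda>(q, rows). ex_belowT (\<lambda>j. allT (\<lambda>(as, v).
        (subsetT as D \<and>\<^sub>T bind_timed (nthT as j) (\<lambda>x. memT x C)) \<longrightarrow>\<^sub>T memT v C) rows) q) tabs)"
    by (rule runs_in_allT) (use N tabs_le tab in auto)
  then show ?thesis unfolding mult_nat_powers by simp
qed

lemma runs_in_blocker_testT:
  assumes C: "distinct C" "set C \<subseteq> carrier \<A>" and D: "distinct D" "set D \<subseteq> carrier \<A>"
  shows "runs_in (465 * N ^ 5) (\<lambda>b. b = op_blocker \<A> (set C) (set D)) (blocker_testT elems tabs C D)"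
proof -
  note l = length_le[OF C] length_le[OF D]
  have "runs_in (0 + (6 * N ^ 2 + (6 * N ^ 2 + (78 * N ^ 4 + (78 * N ^ 4 + 297 * N ^ 5)))))
      (\<lambda>b. b = (C \<noteq> [] \<and> set C \<subseteq> set D \<and> \<not> set D \<subseteq> set C \<and> subuniverse \<A> (set C) \<and> subuniverse \<A> (set D) \<and>
        (\<forall>(q, rows) \<in> set tabs. \<exists>j<q. \<forall>(as, v) \<in> set rows.
          set as \<subseteq> set D \<and> as ! j \<in> set C \<longrightarrow> v \<in> set C)))
      (blocker_testT elems tabs C D)"
    unfolding blocker_testT_def
    by (intro runs_in_and runs_in_not runs_in_ret runs_in_subsetT runs_in_subuniverseT
        runs_in_absorption_test l N C D refl)
  then show ?thesis
  proof (rule runs_in_weaken)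
    fix b assume b: "b = (C \<noteq> [] \<and> set C \<subseteq> set D \<and> \<not> set D \<subseteq> set C \<and> subuniverse \<A> (set C) \<and>
      subuniverse \<A> (set D) \<and> (\<forall>(q, rows) \<in> set tabs. \<exists>j<q. \<forall>(as, v) \<in> set rows.
          set as \<subseteq> set D \<and> as ! j \<in> set C \<longrightarrow> v \<in> set C))"
    show "b = op_blocker \<A> (set C) (set D)"
    \<comment> \<open>When the preliminary checks succeed, the loop over the tables decides
      absorption; when one fails, both sides are false, as the checks are consequences of
      \<open>op_blocker\<close>.\<close>
    proof (cases "C \<noteq> [] \<and> set C \<subset> set D \<and> subuniverse \<A> (set C) \<and> subuniverse \<A> (set D)")
      case True
      then have "op_blocker \<A> (set C) (set D) \<longleftrightarrow> (\<forall>(q, rows) \<in> set tabs. \<exists>j<q. \<forall>(as, v) \<in> set rows.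
          set as \<subseteq> set D \<and> as ! j \<in> set C \<longrightarrow> v \<in> set C)"
        by (intro op_blocker_iff_tabs) auto
      then show ?thesis using b True by blast
    next
      case False
      then show ?thesis
        using b op_blockerD[of \<A> "set C" "set D"] op_blocker_subuniverse[of \<A> "set C" "set D"] by auto
    qed
  qed (use N_powers in linarith)
qed

section \<open>Candidates with a minimal generated subuniverse\<close>

lemma runs_in_minimalsT:
  assumes c: "c \<in> carrier \<A>" and ds: "distinct ds" "set ds \<subseteq> carrier \<A>"
  shows "runs_in (1068 * N ^ 6)
    (\<lambda>ms. ms = filter (\<lambda>d. \<forall>d'\<in>set ds. \<not> Sg \<A> {c, d'} \<subset> Sg \<A> {c, d}) ds) (minimalsT tabs c ds)"
proof -
  have Sg: "Sg \<A> {c, d} \<subseteq> carrier \<A>" if "d \<in> set ds" for d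
    using c ds that by (intro Sg_least subuniverse_carrier alg) auto
  have SgT: "runs_in (160 * N ^ 5) (\<lambda>R. distinct R \<and> set R = Sg \<A> {c, d}) (SgT tabs c d)" if "d \<in> set ds" for d
    using c ds that by (intro runs_in_SgT) auto
  have "runs_in (3 * N * (160 * N ^ 5) + 3 * N * (196 * N ^ 5))
    (\<lambda>ms. ms = filter (\<lambda>d. \<forall>d'\<in>set ds. \<not> Sg \<A> {c, d'} \<subset> Sg \<A> {c, d}) ds) (minimalsT tabs c ds)"
    unfolding minimalsT_def
  proof (rule runs_in_bind)
    show "runs_in (3 * N * (160 * N ^ 5)) (list_all2 (\<lambda>d R. distinct R \<and> set R = Sg \<A> {c, d}) ds)
        (mapT (SgT tabs c) ds)"
      using SgT N length_le[OF ds] by (intro runs_in_mapT) auto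
    fix Gs assume Gs: "list_all2 (\<lambda>d R. distinct R \<and> set R = Sg \<A> {c, d}) ds Gs"
    \<comment> \<open>\<open>dG\<close> and \<open>Gd\<close> together say that \<open>Gs\<close>
      represents exactly the sets \<open>Sg(c,d)\<close> for candidates \<open>d\<close>, so
      comparing with all of \<open>Gs\<close> amounts to comparing with all candidates.\<close>
    have dG: "\<exists>d\<in>set ds. distinct G \<and> set G = Sg \<A> {c, d}" if G: "G \<in> set Gs" for G
    proof -
      obtain i where i: "i < length Gs" "Gs ! i = G" using G by (metis in_set_conv_nth)
      have "distinct (Gs ! i) \<and> set (Gs ! i) = Sg \<A> {c, ds ! i}" by (rule list_all2_nthD2[OF Gs i(1)])
      moreover have "ds ! i \<in> set ds" using i(1) list_all2_lengthD[OF Gs] by simp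
      ultimately show ?thesis unfolding i(2) by blast
    qed
    have Gd: "\<exists>G\<in>set Gs. set G = Sg \<A> {c, d}" if d: "d \<in> set ds" for d
    proof -
      obtain i where i: "i < length ds" "ds ! i = d" using d by (metis in_set_conv_nth)
      have "distinct (Gs ! i) \<and> set (Gs ! i) = Sg \<A> {c, ds ! i}" by (rule list_all2_nthD[OF Gs i(1)])
      moreover have "Gs ! i \<in> set Gs" using i(1) list_all2_lengthD[OF Gs] by simp
      ultimately show ?thesis unfolding i(2) by blast
    qed
    have lG: "length G \<le> N" if "G \<in> set Gs" for G
      using dG[OF that] Sg by (intro length_le) auto
    show "runs_in (3 * N * (196 * N ^ 5))
      (\<lambda>ms. ms = filter (\<lambda>d. \<forall>d'\<in>set ds. \<not> Sg \<A> {c, d'} \<subset> Sg \<A> {c, d}) ds)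
      (filterT (\<lambda>d. bind_timed (SgT tabs c d)
        (\<lambda>G. allT (\<lambda>G'. \<not>\<^sub>T (subsetT G' G \<and>\<^sub>T (\<not>\<^sub>T subsetT G G'))) Gs)) ds)"
    proof (rule runs_in_filterT)
      fix d assume d: "d \<in> set ds"
      have "runs_in (160 * N ^ 5 + 3 * N * (6 * N ^ 2 + 6 * N ^ 2))
          (\<lambda>b. b = (\<forall>d'\<in>set ds. \<not> Sg \<A> {c, d'} \<subset> Sg \<A> {c, d}))
          (bind_timed (SgT tabs c d)
            (\<lambda>G. allT (\<lambda>G'. \<not>\<^sub>T (subsetT G' G \<and>\<^sub>T (\<not>\<^sub>T subsetT G G'))) Gs))"
      proof (rule runs_in_bind[OF SgT[OF d]])
        fix G assume G: "distinct G \<and> set G = Sg \<A> {c, d}"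
        then have lG': "length G \<le> N" using Sg[OF d] by (intro length_le) auto
        have "runs_in (3 * N * (6 * N ^ 2 + 6 * N ^ 2))
            (\<lambda>b. b = (\<forall>G'\<in>set Gs. \<not> (set G' \<subseteq> set G \<and> \<not> set G \<subseteq> set G')))
            (allT (\<lambda>G'. \<not>\<^sub>T (subsetT G' G \<and>\<^sub>T (\<not>\<^sub>T subsetT G G'))) Gs)"
          using lG lG' N length_le[OF ds] list_all2_lengthD[OF Gs]
          by (intro runs_in_allT runs_in_not runs_in_and runs_in_subsetT) auto
        moreover have "(\<forall>G'\<in>set Gs. \<not> (set G' \<subseteq> set G \<and> \<not> set G \<subseteq> set G')) \<longleftrightarrow>
            (\<forall>d'\<in>set ds. \<not> Sg \<A> {c, d'} \<subset> Sg \<A> {c, d})"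
          using dG Gd G by (metis psubset_eq subset_antisym)
        ultimately show "runs_in (3 * N * (6 * N ^ 2 + 6 * N ^ 2))
            (\<lambda>b. b = (\<forall>d'\<in>set ds. \<not> Sg \<A> {c, d'} \<subset> Sg \<A> {c, d}))
            (allT (\<lambda>G'. \<not>\<^sub>T (subsetT G' G \<and>\<^sub>T (\<not>\<^sub>T subsetT G G'))) Gs)"
          by simp
      qed
      then show "runs_in (196 * N ^ 5) (\<lambda>b. b = (\<forall>d'\<in>set ds. \<not> Sg \<A> {c, d'} \<subset> Sg \<A> {c, d}))
          (bind_timed (SgT tabs c d)
            (\<lambda>G. allT (\<lambda>G'. \<not>\<^sub>T (subsetT G' G \<and>\<^sub>T (\<not>\<^sub>T subsetT G G'))) Gs))"
      proof (rule runs_in_weaken)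
        have "3 * N * (6 * N ^ 2 + 6 * N ^ 2) = 36 * N ^ 3"
          unfolding distrib_left mult_nat_powers by simp
        then show "160 * N ^ 5 + 3 * N * (6 * N ^ 2 + 6 * N ^ 2) \<le> 196 * N ^ 5"
          using N_powers by linarith
      qed
    qed (use N length_le[OF ds] in auto)
  qed
  then show ?thesis unfolding mult_nat_powers by (rule runs_in_weaken) simp_all
qed

lemma runs_in_unionT:
  assumes S: "distinct S" "set S \<subseteq> carrier \<A>" and D: "distinct D" "set D \<subseteq> carrier \<A>"
  shows "runs_in (6 * N ^ 2) (\<lambda>R. distinct R \<and> set R = set S \<union> set D) (unionT S D)"
proof -
  have "runs_in (3 * N * (2 * N)) (\<lambda>R. distinct R \<and> set R = set S \<union> set D \<and> set D \<subseteq> carrier \<A>) (unionT S D)"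
    unfolding unionT_def
  \<comment> \<open>Keeping the processed items in the carrier bounds the length of the growing list
    by \<open>N\<close>.\<close>
  proof (rule runs_in_foldT[where I = "\<lambda>M R. distinct R \<and> set R = set S \<union> M \<and> M \<subseteq> carrier \<A>"])
    fix x s M assume "x \<in> set D" and s: "distinct s \<and> set s = set S \<union> M \<and> M \<subseteq> carrier \<A>"
    moreover have "length s \<le> N" using s S by (intro length_le) auto
    ultimately show "runs_in (2 * N)
        (\<lambda>R. distinct R \<and> set R = set S \<union> insert x M \<and> insert x M \<subseteq> carrier \<A>) (insertT x s)"
      using D by (intro runs_in_weaken[OF runs_in_insertT[OF _ _ N]]) auto
  qed (use S N length_le[OF D] in auto)
  then show ?thesis unfolding mult_nat_powers by (rule runs_in_weaken) simp_all
qed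

text \<open>By minimality of \<open>Sg(c,d)\<close>, an element \<open>e\<close> of \<open>Sg(c,d)\<close> outside \<open>S\<close> generates together with
  \<open>c\<close> all of \<open>Sg(c,d)\<close>. Hence if \<open>Sg(c,d)\<close> meets \<open>D\<^sub>0\<close> outside \<open>C\<^sub>0\<close> then it lies inside \<open>D\<^sub>0\<close>, and
  no element of \<open>C\<^sub>0 \<inter> Sg(c,d)\<close> can be outside \<open>S\<close>.\<close>

lemma blocker_step:
  assumes blk: "op_blocker \<A> C0 D0" "c \<in> C0" and S: "c \<in> S" "S \<inter> D0 \<subseteq> C0"
    and d: "d \<in> carrier \<A>"
    and minimal: "\<And>d'. d' \<in> carrier \<A> \<Longrightarrow> d' \<notin> S \<Longrightarrow> \<not> Sg \<A> {c, d'} \<subset> Sg \<A> {c, d}"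
  shows "op_blocker \<A> (S \<inter> Sg \<A> {c, d}) (Sg \<A> {c, d}) \<or> (S \<union> Sg \<A> {c, d}) \<inter> D0 \<subseteq> C0"
proof (cases "Sg \<A> {c, d} \<inter> D0 \<subseteq> C0")
  case True
  then show ?thesis using S by blast
next
  case False
  let ?E = "Sg \<A> {c, d}"
  have D0: "C0 \<subset> D0" "subuniverse \<A> D0" using op_blockerD[OF blk(1)] by auto
  have c: "c \<in> carrier \<A>" using D0 blk(2) subuniverse_subset by blast
  then have E: "subuniverse \<A> ?E" using alg d by (intro subuniverse_Sg) auto
  have cE: "c \<in> ?E" using Sg_superset[of "{c, d}" \<A>] by simp
  have gen: "Sg \<A> {c, e} = ?E" if "e \<in> ?E" "e \<notin> S" for e
  proof -
    have "Sg \<A> {c, e} \<subseteq> ?E" using E cE that by (intro Sg_least) auto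
    then show ?thesis using minimal[of e] that subuniverse_subset[OF E] by blast
  qed
  obtain e where e: "e \<in> ?E" "e \<in> D0" "e \<notin> C0" using False by blast
  then have "Sg \<A> {c, e} = ?E" using S by (intro gen) auto
  then have ED: "?E \<subseteq> D0" using Sg_least[OF D0(2), of "{c, e}"] e D0(1) blk(2) by auto
  have "C0 \<inter> ?E \<subseteq> S"
  proof
    fix a assume a: "a \<in> C0 \<inter> ?E"
    have "Sg \<A> {c, a} \<subseteq> C0"
      using a blk op_blocker_subuniverse[OF blk(1)] by (intro Sg_least) auto
    then show "a \<in> S" using gen[of a] a e by blast
  qed
  then have "C0 \<inter> ?E = S \<inter> ?E" "D0 \<inter> ?E = ?E" using S(2) ED by auto
  moreover have "op_blocker \<A> (C0 \<inter> ?E) (D0 \<inter> ?E)"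
    using blk(2) cE False by (intro op_blocker_restrict[OF blk(1) E]) auto
  ultimately show ?thesis by simp
qed

text \<open>\<open>chooseT\<close> aborts on an empty list; a finite nonempty family of sets has a
  minimal member, which provides a candidate.\<close>

lemma ex_minimal_Sg:
  assumes "ds \<noteq> []"
  shows "filter (\<lambda>d. \<forall>d'\<in>set ds. \<not> Sg \<A> {c, d'} \<subset> Sg \<A> {c, d}) ds \<noteq> []"
proof -
  have "\<exists>m\<in>(\<lambda>d. Sg \<A> {c, d}) ` set ds. \<forall>b\<in>(\<lambda>d. Sg \<A> {c, d}) ` set ds. b \<subseteq> m \<longrightarrow> m = b"
    using assms by (intro finite_has_minimal) auto
  then show ?thesis by (auto simp: filter_empty_conv)
qed

text \<open>The answer \<open>None\<close> excludes the blockers with \<open>c \<in> C0\<close> that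
  are compatible with \<open>S\<close>, that is, \<open>S \<inter> D0 \<subseteq> C0\<close>. The
  dependence on \<open>S\<close> lets the claim pass backwards through the iterations.\<close>

definition run_result :: "'a \<Rightarrow> 'a set \<Rightarrow> ('a list \<times> 'a list) option \<Rightarrow> bool" where
  "run_result c S r = (case r of
      Some (C, D) \<Rightarrow> op_blocker \<A> (set C) (set D)
    | None \<Rightarrow> \<forall>C0 D0. op_blocker \<A> C0 D0 \<longrightarrow> c \<in> C0 \<longrightarrow> \<not> S \<inter> D0 \<subseteq> C0)"

text \<open>The induction is on the number of elements missing from \<open>S\<close>, which drops
  because \<open>d \<notin> S\<close> is added. Unless the test succeeds, a blocker compatible with
  \<open>S\<close> remains compatible with the next set by \<open>blocker_step\<close>, so a
  negative answer for that set transfers back to \<open>S\<close>.\<close>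

lemma runs_in_while_loopT:
  assumes pick: "choice_rule pick"
    and "distinct S" "set S \<subseteq> carrier \<A>" "c \<in> set S"
  shows "runs_in (3440 * N ^ 7) (run_result c (set S)) (while_loopT pick elems tabs c S)"
proof -
  have "runs_in ((card (carrier \<A>) - card (set S) + 1) * (1720 * N ^ 6)) (run_result c (set S))
      (while_loopT pick elems tabs c S)"
    using assms(2-)
  proof (induction "card (carrier \<A>) - card (set S)" arbitrary: S rule: less_induct)
    case less
    note S = less.prems
    let ?m = "card (carrier \<A>) - card (set S)"
    let ?Q = "run_result c (set S)"
    have c: "c \<in> carrier \<A>" using S by blast
    have lS: "length S \<le> N" using length_le S by blast
    have "runs_in (6 * N ^ 2 + (6 * N ^ 2 + (1068 * N ^ 6 + (N + (160 * N ^ 5 + (6 * N ^ 2 + (465 * N ^ 5 +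
        (6 * N ^ 2 + ?m * (1720 * N ^ 6)))))))) + 1) ?Q (while_loopT pick elems tabs c S)"
    proof (subst while_loopT.simps, rule runs_in_tick, rule runs_in_bind[OF runs_in_subsetT[OF elems(3) lS N]])
      fix full assume full: "full = (set elems \<subseteq> set S)"
      show "runs_in (6 * N ^ 2 + (1068 * N ^ 6 + (N + (160 * N ^ 5 + (6 * N ^ 2 + (465 * N ^ 5 +
        (6 * N ^ 2 + ?m * (1720 * N ^ 6)))))))) ?Q (if full then ret None else
          bind_timed (filterT (\<lambda>d. \<not>\<^sub>T memT d S) elems) (\<lambda>ds. bind_timed (minimalsT tabs c ds) (\<lambda>ms.
          bind_timed (chooseT pick c S ms) (\<lambda>d. bind_timed (SgT tabs c d) (\<lambda>D. bind_timed (interT S D) (\<lambda>C.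
          bind_timed (blocker_testT elems tabs C D) (\<lambda>b. if b then ret (Some (C, D)) else
            bind_timed (unionT S D) (while_loopT pick elems tabs c))))))))"
      proof (cases full)
        case True
        then have "set S = carrier \<A>" using full elems S by blast
        \<comment> \<open>With \<open>S\<close> the whole carrier,
          \<open>S \<inter> D0 \<subseteq> C0\<close> would give
          \<open>D0 \<subseteq> C0\<close>.\<close>
        then have "?Q None"
          using op_blockerD subuniverse_subset unfolding run_result_def by fastforce
        then show ?thesis using True by (simp add: runs_in_ret)
      next
        case False
        let ?ds = "filter (\<lambda>d. d \<notin> set S) elems"
        let ?ms = "filter (\<lambda>d. \<forall>d'\<in>set ?ds. \<not> Sg \<A> {c, d'} \<subset> Sg \<A> {c, d}) ?ds"
        have ds: "distinct ?ds" "set ?ds \<subseteq> carrier \<A>" "?ds \<noteq> []" "set ?ds = carrier \<A> - set S"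
          using elems False full by (auto simp: filter_empty_conv)
        have ms: "?ms \<noteq> []" using ex_minimal_Sg[OF ds(3)] .
        have f: "runs_in (6 * N ^ 2) (\<lambda>ds. ds = ?ds) (filterT (\<lambda>d. \<not>\<^sub>T memT d S) elems)"
          using runs_in_filterT[OF runs_in_not[OF runs_in_memT[OF lS N]] elems(3) N] N
          by (simp add: power2_eq_square mult.assoc)
        have ch: "runs_in N (\<lambda>d. d \<in> set ?ms) (chooseT pick c S ?ms)"
        proof -
          have "pick c S ?ms \<in> set ?ms" using pick ms unfolding choice_rule_def by blast
          moreover have "length ?ms \<le> N" 
            by (rule length_le[OF distinct_filter[OF ds(1)] subset_trans[OF filter_is_subset ds(2)]])
          ultimately show ?thesis using ms unfolding runs_in_def chooseT_def by auto
        qed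
        have "runs_in (6 * N ^ 2 + (1068 * N ^ 6 + (N + (160 * N ^ 5 + (6 * N ^ 2 + (465 * N ^ 5 +
          (6 * N ^ 2 + ?m * (1720 * N ^ 6)))))))) ?Q
          (bind_timed (filterT (\<lambda>d. \<not>\<^sub>T memT d S) elems) (\<lambda>ds. bind_timed (minimalsT tabs c ds) (\<lambda>ms.
            bind_timed (chooseT pick c S ms) (\<lambda>d. bind_timed (SgT tabs c d) (\<lambda>D. bind_timed (interT S D) (\<lambda>C.
            bind_timed (blocker_testT elems tabs C D) (\<lambda>b. if b then ret (Some (C, D)) else
              bind_timed (unionT S D) (while_loopT pick elems tabs c))))))))"
        proof (rule runs_in_bind[OF f], hypsubst, rule runs_in_bind[OF runs_in_minimalsT[OF c ds(1,2)]],
            hypsubst, rule runs_in_bind[OF ch])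
          fix d assume "d \<in> set ?ms"
          then have d: "d \<in> carrier \<A>" "d \<notin> set S"
            and minimal: "\<And>d'. d' \<in> carrier \<A> \<Longrightarrow> d' \<notin> set S \<Longrightarrow> \<not> Sg \<A> {c, d'} \<subset> Sg \<A> {c, d}"
            using elems(2) by auto
          show "runs_in (160 * N ^ 5 + (6 * N ^ 2 + (465 * N ^ 5 + (6 * N ^ 2 + ?m * (1720 * N ^ 6))))) ?Q
            (bind_timed (SgT tabs c d) (\<lambda>D. bind_timed (interT S D) (\<lambda>C.
              bind_timed (blocker_testT elems tabs C D) (\<lambda>b. if b then ret (Some (C, D)) else
              bind_timed (unionT S D) (while_loopT pick elems tabs c)))))"
          proof (rule runs_in_bind[OF runs_in_SgT[OF c d(1)]])
            fix D assume D: "distinct D \<and> set D = Sg \<A> {c, d}"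
            have DA: "set D \<subseteq> carrier \<A>"
              using Sg_least[OF subuniverse_carrier[OF alg], of "{c, d}"] D c d by simp
            have lD: "length D \<le> N" using length_le D DA by blast
            have dD: "d \<in> set D" using D Sg_superset[of "{c, d}" \<A>] by simp
            let ?C = "filter (\<lambda>x. x \<in> set D) S"
            have C: "distinct ?C" "set ?C \<subseteq> carrier \<A>" "set ?C = set S \<inter> set D" using S by auto
            show "runs_in (6 * N ^ 2 + (465 * N ^ 5 + (6 * N ^ 2 + ?m * (1720 * N ^ 6)))) ?Q
              (bind_timed (interT S D) (\<lambda>C.
                bind_timed (blocker_testT elems tabs C D) (\<lambda>b. if b then ret (Some (C, D)) else
                bind_timed (unionT S D) (while_loopT pick elems tabs c))))"
            proof (rule runs_in_bind[OF runs_in_interT[OF lS lD N]], hypsubst,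
                rule runs_in_bind[OF runs_in_blocker_testT[OF C(1,2) _ DA]])
              show "distinct D" using D by blast
              fix b assume b: "b = op_blocker \<A> (set ?C) (set D)"
              show "runs_in (6 * N ^ 2 + ?m * (1720 * N ^ 6)) ?Q (if b then ret (Some (?C, D)) else
                bind_timed (unionT S D) (while_loopT pick elems tabs c))"
              proof (cases b)
                case True
                then show ?thesis using b by (simp add: run_result_def runs_in_ret)
              next
                case False
                have "runs_in (6 * N ^ 2 + ?m * (1720 * N ^ 6)) ?Q
                  (bind_timed (unionT S D) (while_loopT pick elems tabs c))"
                proof (rule runs_in_bind[OF runs_in_unionT[OF S(1,2) _ DA]])
                  show "distinct D" using D by blast
                  fix S' assume S': "distinct S' \<and> set S' = set S \<union> set D"
                  have S'A: "set S' \<subseteq> carrier \<A>" using S' S DA by simp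
                  have "set S \<subset> set S'" using S' d dD by blast
                  then have "card (set S) < card (set S')" by (simp add: psubset_card_mono)
                  moreover have "card (set S') \<le> card (carrier \<A>)" using card_mono[OF fin S'A] .
                  ultimately have less_card: "card (carrier \<A>) - card (set S') + 1 \<le> ?m" by simp
                  have "runs_in ((card (carrier \<A>) - card (set S') + 1) * (1720 * N ^ 6))
                      (run_result c (set S')) (while_loopT pick elems tabs c S')"
                    using less.hyps[of S'] less_card S' S'A S by simp
                  then show "runs_in (?m * (1720 * N ^ 6)) ?Q (while_loopT pick elems tabs c S')"
                  proof (rule runs_in_weaken)
                    show "(card (carrier \<A>) - card (set S') + 1) * (1720 * N ^ 6) \<le> ?m * (1720 * N ^ 6)"
                      using less_card by (rule mult_right_mono) simp
                    fix r assume r: "run_result c (set S') r"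
                    show "?Q r"
                    proof (cases r)
                      case None
                      have "\<not> set S \<inter> D0 \<subseteq> C0" if blk: "op_blocker \<A> C0 D0" "c \<in> C0" for C0 D0
                      proof
                        assume SC: "set S \<inter> D0 \<subseteq> C0"
                        \<comment> \<open>As the test failed, the first alternative of
                          \<open>blocker_step\<close> is ruled out.\<close>
                        have "set S' \<inter> D0 \<subseteq> C0"
                          using blocker_step[OF blk S(3) SC d(1) minimal] b False C(3) D S' by auto
                        then show False using r None blk by (simp add: run_result_def)
                      qed
                      then show ?thesis using None by (simp add: run_result_def)
                    next
                      case (Some p)
                      then show ?thesis using r by (simp add: run_result_def)
                    qed
                  qed
                qed
                then show ?thesis using False by simp
              qed
            qed
          qed
        qed
        then show ?thesis using False by simp
      qed
    qed
    then show ?case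
    proof (rule runs_in_weaken)
      show "6 * N ^ 2 + (6 * N ^ 2 + (1068 * N ^ 6 + (N + (160 * N ^ 5 + (6 * N ^ 2 + (465 * N ^ 5 +
        (6 * N ^ 2 + ?m * (1720 * N ^ 6)))))))) + 1 \<le> (?m + 1) * (1720 * N ^ 6)"
        unfolding distrib_right mult_1 using N_powers by linarith
    qed
  qed
  then show ?thesis
  proof (rule runs_in_weaken)
    have "card (carrier \<A>) - card (set S) + 1 \<le> 2 * N" using card_le N by linarith
    then have "(card (carrier \<A>) - card (set S) + 1) * (1720 * N ^ 6) \<le> 2 * N * (1720 * N ^ 6)"
      by (rule mult_right_mono) simp
    then show "(card (carrier \<A>) - card (set S) + 1) * (1720 * N ^ 6) \<le> 3440 * N ^ 7"
      unfolding mult_nat_powers by simp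
  qed
qed

lemma runs_in_BLOCKER:
  assumes pick: "choice_rule pick"
  shows "runs_in (3442 * N ^ 8)
    (\<lambda>r. case r of Some (C, D) \<Rightarrow> op_blocker \<A> (set C) (set D) | None \<Rightarrow> \<nexists>C D. op_blocker \<A> C D)
    (BLOCKER pick elems tabs)"
proof -
  have loop: "runs_in (length cs * (3440 * N ^ 7 + 1) + 1)
    (\<lambda>r. case r of Some (C, D) \<Rightarrow> op_blocker \<A> (set C) (set D)
      | None \<Rightarrow> \<forall>C D. op_blocker \<A> C D \<longrightarrow> set cs \<inter> C = {}) (for_eachT pick elems tabs cs)"
    if "set cs \<subseteq> carrier \<A>" for cs
    using that
  proof (induction cs)
    case Nil
    show ?case by (simp add: runs_in_def tick_def ret_def)
  next
    case (Cons c cs)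
    have "runs_in (3440 * N ^ 7 + (length cs * (3440 * N ^ 7 + 1) + 1))
      (\<lambda>r. case r of Some (C, D) \<Rightarrow> op_blocker \<A> (set C) (set D)
        | None \<Rightarrow> \<forall>C D. op_blocker \<A> C D \<longrightarrow> set (c # cs) \<inter> C = {})
      (bind_timed (while_loopT pick elems tabs c [c])
        (\<lambda>r. case r of None \<Rightarrow> for_eachT pick elems tabs cs | Some CD \<Rightarrow> ret (Some CD)))"
    proof (rule runs_in_bind)
      show "runs_in (3440 * N ^ 7) (run_result c {c}) (while_loopT pick elems tabs c [c])"
        using runs_in_while_loopT[OF pick, of "[c]" c] Cons.prems by simp
      fix r assume r: "run_result c {c} r"
      show "runs_in (length cs * (3440 * N ^ 7 + 1) + 1)
        (\<lambda>r. case r of Some (C, D) \<Rightarrow> op_blocker \<A> (set C) (set D)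
          | None \<Rightarrow> \<forall>C D. op_blocker \<A> C D \<longrightarrow> set (c # cs) \<inter> C = {})
        (case r of None \<Rightarrow> for_eachT pick elems tabs cs | Some CD \<Rightarrow> ret (Some CD))"
      proof (cases r)
        case None
        \<comment> \<open>For \<open>S = {c}\<close> the condition
          \<open>S \<inter> D \<subseteq> C\<close> holds whenever \<open>c \<in> C\<close>.\<close>
        then have "c \<notin> C" if "op_blocker \<A> C D" for C D
          using r that unfolding run_result_def by fastforce
        then have *: "\<forall>C D. op_blocker \<A> C D \<longrightarrow> set (c # cs) \<inter> C = {}"
          if "\<forall>C D. op_blocker \<A> C D \<longrightarrow> set cs \<inter> C = {}"
          using that by fastforce
        have "runs_in (length cs * (3440 * N ^ 7 + 1) + 1)
          (\<lambda>r. case r of Some (C, D) \<Rightarrow> op_blocker \<A> (set C) (set D)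
            | None \<Rightarrow> \<forall>C D. op_blocker \<A> C D \<longrightarrow> set cs \<inter> C = {}) (for_eachT pick elems tabs cs)"
          by (rule Cons.IH) (use Cons.prems in simp)
        then have "runs_in (length cs * (3440 * N ^ 7 + 1) + 1)
          (\<lambda>r. case r of Some (C, D) \<Rightarrow> op_blocker \<A> (set C) (set D)
            | None \<Rightarrow> \<forall>C D. op_blocker \<A> C D \<longrightarrow> set (c # cs) \<inter> C = {}) (for_eachT pick elems tabs cs)"
          by (rule runs_in_weaken[OF _ order_refl]) (use * in \<open>auto split: option.splits simp del: set_simps\<close>)
        then show ?thesis using None by simp
      next
        case (Some CD)
        then show ?thesis using r by (auto simp: run_result_def intro!: runs_in_ret)
      qed
    qed
    from runs_in_tick[OF this] show ?case by (simp add: algebra_simps)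
  qed
  show ?thesis
    unfolding BLOCKER_def
  proof (rule runs_in_weaken[OF loop[of elems]])
    have "length elems * (3440 * N ^ 7 + 1) \<le> N * (3440 * N ^ 7 + 1)"
      using elems(3) by (rule mult_right_mono) simp
    also have "\<dots> = 3440 * N ^ 8 + N" unfolding distrib_left mult_nat_powers by simp
    finally show "length elems * (3440 * N ^ 7 + 1) + 1 \<le> 3442 * N ^ 8" using N_powers by linarith
    fix r
    assume r: "case r of Some (C, D) \<Rightarrow> op_blocker \<A> (set C) (set D)
      | None \<Rightarrow> \<forall>C D. op_blocker \<A> C D \<longrightarrow> set elems \<inter> C = {}"
    show "case r of Some (C, D) \<Rightarrow> op_blocker \<A> (set C) (set D) | None \<Rightarrow> \<nexists>C D. op_blocker \<A> C D"
    proof (cases r)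
      case None
      then have *: "carrier \<A> \<inter> C = {}" if "op_blocker \<A> C D" for C D
        using r that elems(2) by auto
      \<comment> \<open>Every element of the carrier has been tried as \<open>c\<close>, so a
        blocker would have been met at an element of its nonempty \<open>C\<close>.\<close>
      have "C \<noteq> {}" "C \<subseteq> carrier \<A>" if "op_blocker \<A> C D" for C D
        using op_blockerD(1)[OF that] subuniverse_subset[OF op_blocker_subuniverse[OF that]] by auto
      then have "\<nexists>C D. op_blocker \<A> C D" using * by blast
      then show ?thesis using None by simp
    qed (use r in simp)
  qed (use elems in simp)
qed

end

text \<open>For at most one element the arities are not bounded by the input size.\<close>

lemma BLOCKER_small:
  assumes "length elems \<le> 1"
  shows "\<exists>t\<le>6. BLOCKER pick elems tabs = Some (None, t)"
proof (cases elems)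
  case Nil
  then show ?thesis by (simp add: BLOCKER_def tick_def ret_def)
next
  case (Cons c cs)
  then have [simp]: "elems = [c]" using assms by simp
  \<comment> \<open>The loop stops at its first test, as \<open>S = {c}\<close> is already
    everything.\<close>
  have "while_loopT pick [c] tabs c [c] = Some (None, 4)"
    by (subst while_loopT.simps) (simp add: subsetT_def tick_def ret_def bind_timed_def)
  then show ?thesis by (simp add: BLOCKER_def tick_def ret_def bind_timed_def)
qed

lemma no_op_blocker_small:
  assumes "finite (carrier \<A>)" "card (carrier \<A>) \<le> 1"
  shows "\<not> op_blocker \<A> C D"
proof
  assume blk: "op_blocker \<A> C D"
  have "D \<subseteq> carrier \<A>" using subuniverse_subset[OF op_blockerD(3)[OF blk]] .
  moreover obtain c d where "c \<in> C" "c \<in> D" "d \<in> D" "d \<notin> C" using op_blockerD[OF blk] by blast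
  ultimately have "card {c, d} \<le> card (carrier \<A>)" "c \<noteq> d"
    using assms(1) by (auto intro!: card_mono)
  then show False using assms(2) by simp
qed

text \<open>With \<open>k \<ge> 2\<close> elements, an operation of arity \<open>q\<close>
  contributes \<open>k ^ q\<close> to the input size. This bounds its number of rows and, by
  \<open>q < 2 ^ q \<le> k ^ q\<close>, its arity; as each contribution is at least 1, the number of
  operations is bounded too.\<close>

lemma presented_algebra_input_size:
  assumes alg: "algebra \<A>" and fin: "finite (carrier \<A>)"
    and pres: "presents elems tabs \<A>" and two: "2 \<le> card (carrier \<A>)"
  shows "presented_algebra \<A> elems tabs (input_size \<A>)"
proof
  let ?k = "card (carrier \<A>)"
  have *: "list_all2 (table_of (carrier \<A>)) (ops \<A>) tabs" using pres by (simp add: presents_def)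
  show "algebra \<A>" "finite (carrier \<A>)" "presents elems tabs \<A>" by fact+
  show "1 \<le> input_size \<A>" "?k \<le> input_size \<A>" using two by (simp_all add: input_size_def)
  have "length ops \<le> (\<Sum>(q, f) \<leftarrow> ops. ?k ^ q)" for ops :: "(nat \<times> ('a list \<Rightarrow> 'a)) list"
  proof (induction ops)
    case (Cons op ops)
    have "1 \<le> ?k ^ fst op" using two by (simp add: Suc_le_eq)
    with Cons show ?case by (simp add: case_prod_beta)
  qed simp
  from this[of "ops \<A>"] show "length tabs \<le> input_size \<A>"
    using list_all2_lengthD[OF *] by (simp add: input_size_def)
  fix q rows assume "(q, rows) \<in> set tabs"
  then obtain i where i: "i < length tabs" "tabs ! i = (q, rows)" by (metis in_set_conv_nth)
  then have t: "table_of (carrier \<A>) (ops \<A> ! i) (q, rows)" "i < length (ops \<A>)"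
    using list_all2_nthD2[OF * i(1)] list_all2_lengthD[OF *] by auto
  obtain f where f: "ops \<A> ! i = (q, f)" using t(1) by (cases "ops \<A> ! i") (auto simp: table_of_def)
  have op: "(q, f) \<in> set (ops \<A>)" using f t(2) by (metis nth_mem)
  have "?k ^ q \<le> (\<Sum>(q, f) \<leftarrow> ops \<A>. ?k ^ q)"
    using op by (intro member_le_sum_list) force+
  then have k: "?k ^ q \<le> input_size \<A>" by (simp add: input_size_def)
  have "set rows = (\<lambda>as. (as, f as)) ` {as. set as \<subseteq> carrier \<A> \<and> length as = q}" "distinct rows"
    using t(1) f by (auto simp: table_of_def)
  then have "length rows \<le> card {as. set as \<subseteq> carrier \<A> \<and> length as = q}"
    using card_image_le[OF finite_lists_length_eq[OF fin], of "\<lambda>as. (as, f as)" q]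
    by (simp add: distinct_card[symmetric])
  then have "length rows \<le> input_size \<A>" using k fin by (simp add: card_lists_length_eq)
  moreover have "q < 2 ^ q" "2 ^ q \<le> ?k ^ q" using two by (simp_all add: power_mono)
  ultimately show "q \<le> input_size \<A> \<and> length rows \<le> input_size \<A>" using k by linarith
qed

theorem theorem23:
  shows "\<exists>p :: nat poly. \<forall>(\<A> :: 'a alg) elems tabs pick.
    algebra \<A> \<longrightarrow> finite (carrier \<A>) \<longrightarrow> idempotent \<A> \<longrightarrow> presents elems tabs \<A> \<longrightarrow>
    choice_rule pick \<longrightarrow>
    (\<exists>r t. BLOCKER pick elems tabs = Some (r, t) \<and> t \<le> poly p (input_size \<A>) \<and>
       (case r of
          Some (C, D) \<Rightarrow> cube_term_blocker \<A> (set C) (set D)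
        | None \<Rightarrow> has_cube_term \<A> \<and> \<not> (\<exists>C D. cube_term_blocker \<A> C D)))"
\<comment> \<open>The monomial is the bound for at least two elements; the constant 6 covers the
  remaining case.\<close>
proof (intro exI[of _ "monom 3442 8 + 6"] allI impI)
  fix \<A> :: "'a alg" and elems tabs and pick :: "'a choice_rule"
  assume alg: "algebra \<A>" and fin: "finite (carrier \<A>)" and idem: "idempotent \<A>"
    and pres: "presents elems tabs \<A>" and pick: "choice_rule pick"
  have poly: "poly (monom 3442 8 + 6) (input_size \<A>) = 3442 * input_size \<A> ^ 8 + 6"
    by (simp add: poly_monom)
  have len: "length elems = card (carrier \<A>)"
    using pres by (auto simp: presents_def dest: distinct_card)
  have "\<exists>r t. BLOCKER pick elems tabs = Some (r, t) \<and> t \<le> 3442 * input_size \<A> ^ 8 + 6 \<and>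
    (case r of Some (C, D) \<Rightarrow> op_blocker \<A> (set C) (set D) | None \<Rightarrow> \<nexists>C D. op_blocker \<A> C D)"
  proof (cases "card (carrier \<A>) \<le> 1")
    case True
    then obtain t where "t \<le> 6" "BLOCKER pick elems tabs = Some (None, t)"
      using BLOCKER_small[of elems pick tabs] len by auto
    then show ?thesis using no_op_blocker_small[OF fin True] by (auto intro: trans_le_add2)
  next
    case False
    interpret presented_algebra \<A> elems tabs "input_size \<A>"
      by (rule presented_algebra_input_size[OF alg fin pres]) (use False in simp)
    show ?thesis using runs_in_BLOCKER[OF pick] unfolding runs_in_def by (meson trans_le_add1)
  qed
  then obtain r t where r: "BLOCKER pick elems tabs = Some (r, t)" "t \<le> 3442 * input_size \<A> ^ 8 + 6"
    "case r of Some (C, D) \<Rightarrow> op_blocker \<A> (set C) (set D) | None \<Rightarrow> \<nexists>C D. op_blocker \<A> C D"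
    by blast
  have "case r of Some (C, D) \<Rightarrow> cube_term_blocker \<A> (set C) (set D)
    | None \<Rightarrow> has_cube_term \<A> \<and> \<not> (\<exists>C D. cube_term_blocker \<A> C D)"
  proof (cases r)
    case None
    then have no: "\<nexists>C D. op_blocker \<A> C D" using r(3) by simp
    then have "has_cube_term \<A>" by (rule no_op_blocker_imp_cube_term[OF alg idem fin])
    moreover have "\<nexists>C D. cube_term_blocker \<A> C D"
      using no cube_term_blocker_imp_op_blocker[OF idem] by blast
    ultimately show ?thesis using None by simp
  next
    case (Some p)
    then show ?thesis using r(3) by (auto intro: op_blocker_imp_cube_term_blocker split: prod.splits)
  qed
  then show "\<exists>r t. BLOCKER pick elems tabs = Some (r, t) \<and> t \<le> poly (monom 3442 8 + 6) (input_size \<A>) \<and>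
       (case r of
          Some (C, D) \<Rightarrow> cube_term_blocker \<A> (set C) (set D)
        | None \<Rightarrow> has_cube_term \<A> \<and> \<not> (\<exists>C D. cube_term_blocker \<A> C D))"
    using r(1,2) poly by auto
qed

end
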